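(* Let $f$ be a relation on a Hausdorff uniform space $(X,\mathcal U)$. The closed equivalence relations $1_X\cup(\mathcal A_{\mathcal U}f\cap\mathcal A_{\mathcal U}f^{-1})$ and $1_X\cup(\mathcal C_{\mathcal U}f\cap\mathcal C_{\mathcal U}f^{-1})$ on $X$ have completely Hausdorff quotients. On $|\mathcal C_{\mathcal U}f|$ the equivalence relation $\mathcal C_{\mathcal U}f\cap\mathcal C_{\mathcal U}f^{-1}$ has a totally disconnected quotient. If $X$ is a locally compact, $\sigma$-compact Hausdorff space, then the quotients are Hausdorff and normal and $|\mathcal C_{\mathcal U}f|/[\mathcal C_{\mathcal U}f\cap\mathcal C_{\mathcal U}f^{-1}]$ is Hausdorff and strongly zero-dimensional.
   Context: A relation on $X$ is a subset of $X\times X$; $f^{-1}=\{(y,x):(x,y)\in f\}$; $|F|=\{x:(x,x)\in F\}$; $1_X$ is the diagonal. The gage $\Gamma(\mathcal U)$ is the set of all bounded pseudo-metrics $d$ on $X$ with $\{(x,y):d(x,y)<\epsilon\}\in\mathcal U$ for every $\epsilon>0$. $\mathcal C_{\mathcal U}f$ is the set of $(x,y)$ such that for every $d\in\Gamma(\mathcal U)$ and $\epsilon>0$ there are $n\ge1$ and $(a_1,b_1),\dots,(a_n,b_n)\in f$ with $\max(d(x,a_1),d(b_1,a_2),\dots,d(b_{n-1},a_n),d(b_n,y))<\epsilon$. $\mathcal A_{\mathcal U}f$ is defined the same way with the condition $d(x,a_1)+\sum_{i=1}^{n-1}d(b_i,a_{i+1})+d(b_n,y)<\epsilon$. One has $\mathcal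 A_{\mathcal U}(f^{-1})=(\mathcal A_{\mathcal U}f)^{-1}$ and $\mathcal C_{\mathcal U}(f^{-1})=(\mathcal C_{\mathcal U}f)^{-1}$, so parentheses are omitted. A space $Y$ is completely Hausdorff if the bounded continuous real-valued functions distinguish its points; totally disconnected if for each $y$ the intersection of all clopen sets containing $y$ is $\{y\}$; strongly zero-dimensional if every neighborhood of every closed set $C$ contains a clopen set containing $C$. Quotients carry the quotient topology. *)

theory Defs
  imports "HOL-Analysis.Analysis"
begin

definition pseudometric :: "('a \<Rightarrow> 'a \<Rightarrow> real) \<Rightarrow> bool" where
  "pseudometric d \<longleftrightarrow>
     (\<forall>x y. 0 \<le> d x y) \<and> (\<forall>x. d x x = 0) \<and> (\<forall>x y. d x y = d y x) \<and>
     (\<forall>x y z. d x z \<le> d x y + d y z)"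

definition gage :: "('a \<times> 'a) filter \<Rightarrow> ('a \<Rightarrow> 'a \<Rightarrow> real) set" where
  "gage U = {d. pseudometric d \<and> (\<exists>B. \<forall>x y. d x y \<le> B) \<and>
                (\<forall>\<epsilon>>0. eventually (\<lambda>(x, y). d x y < \<epsilon>) U)}"

text \<open>A chain of length n is given by sequences \<open>a\<close>, \<open>b\<close>, of which only the entries with
  index in \<open>{1..n}\<close> matter.\<close>

definition conley :: "('a \<times> 'a) filter \<Rightarrow> 'a rel \<Rightarrow> 'a rel" where
  "conley U f = {(x, y). \<forall>d\<in>gage U. \<forall>\<epsilon>>0. \<exists>n\<ge>1. \<exists>a b :: nat \<Rightarrow> 'a.
     (\<forall>i\<in>{1..n}. (a i, b i) \<in> f) \<and>
     Max ({d x (a 1), d (b n) y} \<union> (\<lambda>i. d (b i) (a (i + 1))) ` {1..<n}) < \<epsilon>}"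

definition aubry_mather :: "('a \<times> 'a) filter \<Rightarrow> 'a rel \<Rightarrow> 'a rel" where
  "aubry_mather U f = {(x, y). \<forall>d\<in>gage U. \<forall>\<epsilon>>0. \<exists>n\<ge>1. \<exists>a b :: nat \<Rightarrow> 'a.
     (\<forall>i\<in>{1..n}. (a i, b i) \<in> f) \<and>
     d x (a 1) + (\<Sum>i\<in>{1..<n}. d (b i) (a (i + 1))) + d (b n) y < \<epsilon>}"

definition fixed_set :: "'a rel \<Rightarrow> 'a set" where
  "fixed_set F = {x. (x, x) \<in> F}"

definition quotient_topology :: "'a topology \<Rightarrow> 'a rel \<Rightarrow> 'a set topology" where
  "quotient_topology X r =
     topology (\<lambda>W. W \<subseteq> topspace X // r \<and> openin X {x \<in> topspace X. r `` {x} \<in> W})"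

lemma openin_quotient_topology:
  "openin (quotient_topology X r) W \<longleftrightarrow>
     W \<subseteq> topspace X // r \<and> openin X {x \<in> topspace X. r `` {x} \<in> W}"
proof -
  let ?P = "\<lambda>W. W \<subseteq> topspace X // r \<and> openin X {x \<in> topspace X. r `` {x} \<in> W}"
  have "istopology ?P"
    unfolding istopology_def
  proof (intro conjI allI impI)
    fix S T assume S: "?P S" and T: "?P T"
    then show "S \<inter> T \<subseteq> topspace X // r" by blast
    have "{x \<in> topspace X. r `` {x} \<in> S \<inter> T} =
      {x \<in> topspace X. r `` {x} \<in> S} \<inter> {x \<in> topspace X. r `` {x} \<in> T}" by blast
    then show "openin X {x \<in> topspace X. r `` {x} \<in> S \<inter> T}" using S T by auto
  next
    fix \<K> assume K: "\<forall>K\<in>\<K>. ?P K"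
    then show "\<Union>\<K> \<subseteq> topspace X // r" by blast
    have "{x \<in> topspace X. r `` {x} \<in> \<Union>\<K>} = (\<Union>K\<in>\<K>. {x \<in> topspace X. r `` {x} \<in> K})"
      by blast
    then show "openin X {x \<in> topspace X. r `` {x} \<in> \<Union>\<K>}" using K by auto
  qed
  then show ?thesis
    unfolding quotient_topology_def by (simp add: topology_inverse')
qed

lemma topspace_quotient_topology: "topspace (quotient_topology X r) = topspace X // r"
proof -
  have "{x \<in> topspace X. r `` {x} \<in> topspace X // r} = topspace X"
    by (auto simp: quotientI)
  then have "openin (quotient_topology X r) (topspace X // r)"
    by (simp add: openin_quotient_topology)
  then show ?thesis
    by (meson openin_quotient_topology openin_subset openin_topspace subset_antisym)
qed

lemma quotient_map_quotient_topology:
  "quotient_map X (quotient_topology X r) (\<lambda>x. r `` {x})"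
  unfolding quotient_map_def
  by (auto simp: topspace_quotient_topology openin_quotient_topology quotient_def)

definition completely_Hausdorff_space :: "'a topology \<Rightarrow> bool" where
  "completely_Hausdorff_space Y \<longleftrightarrow>
     (\<forall>x\<in>topspace Y. \<forall>y\<in>topspace Y. x \<noteq> y \<longrightarrow>
       (\<exists>g. continuous_map Y euclideanreal g \<and> bounded (g ` topspace Y) \<and> g x \<noteq> g y))"

text \<open>Quasi-components, not connected components, are required to be singletons.\<close>

definition totally_disconnected_space :: "'a topology \<Rightarrow> bool" where
  "totally_disconnected_space Y \<longleftrightarrow>
     (\<forall>y\<in>topspace Y. \<Inter>{W. closedin Y W \<and> openin Y W \<and> y \<in> W} = {y})"

definition strongly_zero_dimensional_space :: "'a topology \<Rightarrow> bool" where
  "strongly_zero_dimensional_space Y \<longleftrightarrow>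
     (\<forall>C N. closedin Y C \<and> N \<subseteq> topspace Y \<and> (\<exists>G. openin Y G \<and> C \<subseteq> G \<and> G \<subseteq> N) \<longrightarrow>
       (\<exists>W. closedin Y W \<and> openin Y W \<and> C \<subseteq> W \<and> W \<subseteq> N))"

definition sigma_compact_space :: "'a topology \<Rightarrow> bool" where
  "sigma_compact_space X \<longleftrightarrow>
     (\<exists>K :: nat \<Rightarrow> 'a set. (\<forall>n. compactin X (K n)) \<and> (\<Union>n. K n) = topspace X)"

end

theory Submission
  imports Defs
begin

text \<open>For a gage element \<open>d\<close>, the infimum of \<open>d x y\<close> and of the costs of all chains from \<open>x\<close> to \<open>y\<close>
  satisfies the triangle inequality and is bounded by \<open>d\<close>. Its symmetrization is therefore again a
  gage element, and the two equivalence relations on the whole space are the common zero sets of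
  these pseudometrics, which descend to the quotient and separate its points. That gages separate
  points is the usual construction of a uniformly continuous function from a sequence of entourages.
  On the Conley recurrent set, a point can be replaced by a nearby one at the end of a chain after
  inserting a cheap loop, so the set of points reached from \<open>x\<close> by chains of cost less than
  \<open>\<epsilon>\<close> is clopen; it is saturated, and these sets separate the classes.
  A locally compact, sigma-compact Hausdorff space carries the weak topology of an increasing sequence
  of compact sets. This passes to closed subspaces and to Hausdorff quotients, where closed sets can
  then be separated inductively, one compact set at a time.\<close>

section \<open>Chains and their costs\<close>

text \<open>The proposition \<open>chain_cost m f d y x t\<close> concerns chains from \<open>x\<close> to \<open>y\<close>: the endpoint comes
  first because it is a parameter of the induction. The combining operation \<open>m\<close> is addition for
  the Aubry-Mather relation and the maximum for the Conley relation.\<close>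

inductive chain_cost ::
  "(real \<Rightarrow> real \<Rightarrow> real) \<Rightarrow> 'a rel \<Rightarrow> ('a \<Rightarrow> 'a \<Rightarrow> real) \<Rightarrow> 'a \<Rightarrow> 'a \<Rightarrow> real \<Rightarrow> bool"
  for m f d y where
  single: "(a, b) \<in> f \<Longrightarrow> chain_cost m f d y x (m (d x a) (d b y))"
| step: "(a, b) \<in> f \<Longrightarrow> chain_cost m f d y b t \<Longrightarrow> chain_cost m f d y x (m (d x a) t)"

text \<open>Only the recursion that peels off the first link is assumed of the cost \<open>S\<close>
  of a pair of sequences, so one induction in each direction serves both the sum and the
  maximum.\<close>

lemma chain_cost_iff_sequences:
  fixes S :: "'a \<Rightarrow> (nat \<Rightarrow> 'a) \<Rightarrow> (nat \<Rightarrow> 'a) \<Rightarrow> nat \<Rightarrow> real"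
  assumes S1: "\<And>x a b. S x a b 1 = m (d x (a 1)) (d (b 1) y)"
    and S2: "\<And>x a b n. 1 \<le> n \<Longrightarrow>
               S x a b (Suc n) = m (d x (a 1)) (S (b 1) (\<lambda>i. a (Suc i)) (\<lambda>i. b (Suc i)) n)"
  shows "(\<exists>t<\<epsilon>. chain_cost m f d y x t) \<longleftrightarrow>
    (\<exists>n\<ge>1. \<exists>a b. (\<forall>i\<in>{1..n}. (a i, b i) \<in> f) \<and> S x a b n < \<epsilon>)"
proof
  \<comment> \<open>Prescribing the unused entries at index 0 makes prepending a link a plain \<open>case_nat\<close>.\<close>
  have *: "\<exists>n\<ge>1. \<exists>a b. a 0 = a0 \<and> b 0 = b0 \<and> (\<forall>i\<in>{1..n}. (a i, b i) \<in> f) \<and> S x a b n = t"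
    if "chain_cost m f d y x t" for a0 b0 x t
    using that
  proof (induction arbitrary: a0 b0)
    case (single a b x)
    show ?case
      by (rule exI[of _ 1], intro conjI, simp, rule exI[of _ "case_nat a0 (\<lambda>_. a)"],
          rule exI[of _ "case_nat b0 (\<lambda>_. b)"]) (use single in \<open>simp add: S1[simplified]\<close>)
  next
    case (step a b t x)
    \<comment> \<open>The induction hypothesis is taken with the entries \<open>a\<close>,
      \<open>b\<close> at index 0; \<open>case_nat\<close> shifts them to index 1, where they form
      the new first link.\<close>
    obtain n a' b' where n: "n \<ge> 1" "a' 0 = a" "b' 0 = b"
      "\<forall>i\<in>{1..n}. (a' i, b' i) \<in> f" "S b a' b' n = t"
      using step.IH[of a b] by (elim exE conjE)
    have link: "(case_nat a0 a' i, case_nat b0 b' i) \<in> f" if "i \<in> {1..Suc n}" for i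
      using that n step.hyps(1)
      by (cases i rule: nat.exhaust[case_product nat.exhaust[of "i - 1"]]) auto
    show ?case
      by (rule exI[of _ "Suc n"], intro conjI, simp, rule exI[of _ "case_nat a0 a'"],
          rule exI[of _ "case_nat b0 b'"]) (use n link in \<open>simp add: S2\<close>)
  qed
  assume "\<exists>t<\<epsilon>. chain_cost m f d y x t"
  then obtain t where "t < \<epsilon>" "chain_cost m f d y x t" by blast
  with *[OF this(2)] show "\<exists>n\<ge>1. \<exists>a b. (\<forall>i\<in>{1..n}. (a i, b i) \<in> f) \<and> S x a b n < \<epsilon>"
    by metis
next
  have "chain_cost m f d y x (S x a b n)" if "n \<ge> 1" "\<forall>i\<in>{1..n}. (a i, b i) \<in> f" for n a b
    using that
  proof (induction n arbitrary: x a b rule: dec_induct)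
    case base
    then show ?case using single[of "a 1" "b 1" f m d y x] by (simp add: S1[simplified])
  next
    case (step n)
    have "chain_cost m f d y (b 1) (S (b 1) (\<lambda>i. a (Suc i)) (\<lambda>i. b (Suc i)) n)"
      using step.prems by (intro step.IH) auto
    then show ?case
      using step.prems step.hyps chain_cost.step[of "a 1" "b 1" f m d y _ x] by (simp add: S2)
  qed
  then show "\<exists>n\<ge>1. \<exists>a b. (\<forall>i\<in>{1..n}. (a i, b i) \<in> f) \<and> S x a b n < \<epsilon> \<Longrightarrow>
      \<exists>t<\<epsilon>. chain_cost m f d y x t"
    by (elim exE conjE) blast
qed

definition chain_rel :: "(real \<Rightarrow> real \<Rightarrow> real) \<Rightarrow> ('a \<times> 'a) filter \<Rightarrow> 'a rel \<Rightarrow> 'a rel" where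
  "chain_rel m U f = {(x, y). \<forall>d\<in>gage U. \<forall>\<epsilon>>0. \<exists>t<\<epsilon>. chain_cost m f d y x t}"

lemma aubry_mather_eq_chain_rel: "aubry_mather U f = chain_rel (+) U f"
proof -
  have shift: "(\<Sum>i\<in>{1..<Suc n}. h i) = h 1 + (\<Sum>i\<in>{1..<n}. h (Suc i))" if "1 \<le> n"
    for h :: "nat \<Rightarrow> real" and n
  proof -
    have "(\<Sum>i\<in>{1..<Suc n}. h i) = h 1 + (\<Sum>i\<in>{Suc 1..<Suc n}. h i)"
      using that by (intro sum.atLeast_Suc_lessThan) simp
    then show ?thesis by (simp only: sum.shift_bounds_Suc_ivl)
  qed
  have "(\<exists>t<\<epsilon>. chain_cost (+) f d y x t) \<longleftrightarrow> (\<exists>n\<ge>1. \<exists>a b :: nat \<Rightarrow> _. (\<forall>i\<in>{1..n}. (a i, b i) \<in> f) \<and>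
      d x (a 1) + (\<Sum>i\<in>{1..<n}. d (b i) (a (i + 1))) + d (b n) y < \<epsilon>)" for d x y \<epsilon>
    by (rule chain_cost_iff_sequences[where S =
          "\<lambda>x a b n. d x (a 1) + (\<Sum>i\<in>{1..<n}. d (b i) (a (i + 1))) + d (b n) y"])
      (simp, subst shift, simp_all)
  then show ?thesis
    unfolding aubry_mather_def chain_rel_def by (simp only:)
qed

lemma conley_eq_chain_rel: "conley U f = chain_rel max U f"
proof -
  have *: "{1..<Suc n} = insert 1 (Suc ` {1..<n})" if "1 \<le> n" for n
    using that by (simp only: image_Suc_atLeastLessThan) auto
  have img: "h ` {1..<Suc n} = insert (h 1) ((\<lambda>i. h (Suc i)) ` {1..<n})" if "1 \<le> n"
    for h :: "nat \<Rightarrow> real" and n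
    by (simp only: *[OF that] image_insert image_image)
  have "(\<exists>t<\<epsilon>. chain_cost max f d y x t) \<longleftrightarrow> (\<exists>n\<ge>1. \<exists>a b :: nat \<Rightarrow> _. (\<forall>i\<in>{1..n}. (a i, b i) \<in> f) \<and>
      Max ({d x (a 1), d (b n) y} \<union> (\<lambda>i. d (b i) (a (i + 1))) ` {1..<n}) < \<epsilon>)" for d x y \<epsilon>
  proof (rule chain_cost_iff_sequences[where S = "\<lambda>x a b n.
      Max ({d x (a 1), d (b n) y} \<union> (\<lambda>i. d (b i) (a (i + 1))) ` {1..<n})"])
    fix x a b and n :: nat assume "1 \<le> n"
    then have "{d x (a 1), d (b (Suc n)) y} \<union> (\<lambda>i. d (b i) (a (i + 1))) ` {1..<Suc n} =
      insert (d x (a 1)) ({d (b 1) (a (Suc 1)), d (b (Suc n)) y} \<union>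
        (\<lambda>i. d (b (Suc i)) (a (Suc (i + 1)))) ` {1..<n})"
      by (subst img) (auto simp: insert_commute)
    then show "Max ({d x (a 1), d (b (Suc n)) y} \<union> (\<lambda>i. d (b i) (a (i + 1))) ` {1..<Suc n}) =
      max (d x (a 1)) (Max ({d (b 1) (a (Suc 1)), d (b (Suc n)) y} \<union>
        (\<lambda>i. d (b (Suc i)) (a (Suc (i + 1)))) ` {1..<n}))"
      by (simp only:) (rule Max_insert; simp)
  qed simp
  then show ?thesis
    unfolding conley_def chain_rel_def by (simp only:)
qed

lemma chain_relD:
  "(x, y) \<in> chain_rel m U f \<Longrightarrow> d \<in> gage U \<Longrightarrow> 0 < \<epsilon> \<Longrightarrow> \<exists>t<\<epsilon>. chain_cost m f d y x t"
  unfolding chain_rel_def by blast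

text \<open>These are the properties of addition and maximum that the chain arguments use. The two
  subadditivity laws say that lengthening one gap by \<open>t\<close> raises the total cost by at
  most \<open>t\<close>, also for the maximum.\<close>

locale chain_op =
  fixes m :: "real \<Rightarrow> real \<Rightarrow> real"
  assumes assoc: "m (m p q) r = m p (m q r)"
    and mono: "p \<le> p' \<Longrightarrow> q \<le> q' \<Longrightarrow> m p q \<le> m p' q'"
    and nonneg: "0 \<le> p \<Longrightarrow> 0 \<le> q \<Longrightarrow> 0 \<le> m p q"
    and subadd_left: "0 \<le> t \<Longrightarrow> m (t + p) q \<le> t + m p q"
    and subadd_right: "0 \<le> t \<Longrightarrow> m p (q + t) \<le> m p q + t"

lemma chain_op_plus: "chain_op (+)" and chain_op_max: "chain_op max"
  by unfold_locales auto

lemma pseudometricD: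
  assumes "pseudometric d"
  shows "0 \<le> d x y" "d x x = 0" "d x y = d y x" "d x z \<le> d x y + d y z"
  using assms unfolding pseudometric_def by blast+

context chain_op
begin

lemma chain_cost_nonneg:
  assumes "pseudometric d" "chain_cost m f d y x t"
  shows "0 \<le> t"
  using assms(2) by induction (use assms(1) in \<open>auto intro!: nonneg simp: pseudometricD\<close>)

text \<open>Only the first gap involves the starting point, so the links are kept and the triangle
  inequality is applied to that gap.\<close>

lemma chain_cost_change_start:
  assumes d: "pseudometric d" and "chain_cost m f d y x t"
  shows "\<exists>u\<le>d x' x + t. chain_cost m f d y x' u"
proof -
  have *: "m (d x' a) r \<le> d x' x + m (d x a) r" for a r
    using mono[OF pseudometricD(4)[OF d, of x' a x] order_refl]
      subadd_left[OF pseudometricD(1)[OF d, of x' x]]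
    by (rule order_trans)
  show ?thesis
    using assms(2)
  proof cases
    case (single a b)
    then show ?thesis by (intro exI[of _ "m (d x' a) (d b y)"]) (simp add: * chain_cost.single)
  next
    case (step a b t)
    then show ?thesis by (intro exI[of _ "m (d x' a) t"]) (simp add: * chain_cost.step)
  qed
qed

text \<open>The endpoint enters only through the last gap; \<open>subadd_right\<close> carries the
  extra \<open>d y y'\<close> outwards through the preceding links.\<close>

lemma chain_cost_change_end:
  assumes d: "pseudometric d" and "chain_cost m f d y x t"
  shows "\<exists>u\<le>t + d y y'. chain_cost m f d y' x u"
  using assms(2)
proof induction
  case (single a b x)
  have "m (d x a) (d b y') \<le> m (d x a) (d b y) + d y y'"
    using mono[OF order_refl pseudometricD(4)[OF d, of b y' y]]
      subadd_right[OF pseudometricD(1)[OF d, of y y']]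
    by (rule order_trans)
  then show ?case
    using chain_cost.single[OF single, of m d y' x] by (intro exI conjI)
next
  case (step a b t x)
  then obtain u where u: "u \<le> t + d y y'" "chain_cost m f d y' b u" by auto
  have "m (d x a) u \<le> m (d x a) t + d y y'"
    using mono[OF order_refl u(1)] subadd_right[OF pseudometricD(1)[OF d, of y y']]
    by (rule order_trans)
  then show ?case
    using chain_cost.step[OF step.hyps(1) u(2), of x] by (intro exI conjI)
qed

text \<open>The first chain ends exactly where the link \<open>(a, b)\<close> starts, so its last
  gap is the gap before that link and associativity alone regroups the cost.\<close>

lemma chain_cost_append:
  assumes "chain_cost m f d a x u" and "(a, b) \<in> f"
  shows "chain_cost m f d z x (m u (d b z))"
    and "chain_cost m f d z b t \<Longrightarrow> chain_cost m f d z x (m u t)"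
  using assms by (induction) (auto simp: assoc intro: single step)

text \<open>The point \<open>y\<close> need not be the source of a link. The end of the first chain
  is therefore moved to the source \<open>a\<close> of the first link of the second chain; the price
  \<open>d y a\<close> is the gap with which the second chain starts, so it is not paid
  twice.\<close>

lemma chain_cost_trans:
  assumes d: "pseudometric d"
    and xy: "chain_cost m f d y x s" and yz: "chain_cost m f d z y t"
  shows "\<exists>u\<le>s + t. chain_cost m f d z x u"
proof -
  have *: "m u r \<le> s + m (d y a) r" if "u \<le> s + d y a" for a u r
    using mono[OF that order_refl[of r]] subadd_left[OF chain_cost_nonneg[OF d xy]]
    by (rule order_trans)
  show ?thesis
    using yz
  proof cases
    case (single a b)
    obtain u where u: "u \<le> s + d y a" "chain_cost m f d a x u"
      using chain_cost_change_end[OF d xy, of a] by auto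
    then have "chain_cost m f d z x (m u (d b z))" "m u (d b z) \<le> s + t"
      using single by (auto intro: * chain_cost_append)
    then show ?thesis by auto
  next
    case (step a b t')
    obtain u where u: "u \<le> s + d y a" "chain_cost m f d a x u"
      using chain_cost_change_end[OF d xy, of a] by auto
    then have "chain_cost m f d z x (m u t')" "m u t' \<le> s + t"
      using step by (auto intro: * chain_cost_append)
    then show ?thesis by auto
  qed
qed

lemma chain_cost_mono:
  assumes "chain_cost m f d' y x t" and le: "\<And>x y. d x y \<le> d' x y"
  shows "\<exists>u\<le>t. chain_cost m f d y x u"
  using assms(1)
proof induction
  case (single a b x)
  show ?case
    using mono[OF le le] chain_cost.single[OF single] by (intro exI conjI)
next
  case (step a b t x)
  then obtain u where u: "u \<le> t" "chain_cost m f d y b u" by auto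
  show ?case
    using mono[OF le u(1)] chain_cost.step[OF step.hyps(1) u(2)] by (intro exI conjI)
qed

lemma trans_chain_rel: "trans (chain_rel m U f)"
proof (rule transI)
  fix x y z assume xy: "(x, y) \<in> chain_rel m U f" and yz: "(y, z) \<in> chain_rel m U f"
  have "\<exists>u<\<epsilon>. chain_cost m f d z x u" if "d \<in> gage U" "\<epsilon> > 0" for d \<epsilon>
  proof -
    obtain s where s: "s < \<epsilon>/2" "chain_cost m f d y x s"
      using chain_relD[OF xy \<open>d \<in> gage U\<close>, of "\<epsilon>/2"] \<open>\<epsilon> > 0\<close> half_gt_zero by blast
    obtain t where t: "t < \<epsilon>/2" "chain_cost m f d z y t"
      using chain_relD[OF yz \<open>d \<in> gage U\<close>, of "\<epsilon>/2"] \<open>\<epsilon> > 0\<close> half_gt_zero by blast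
    obtain u where "u \<le> s + t" "chain_cost m f d z x u"
      using chain_cost_trans[OF _ s(2) t(2)] \<open>d \<in> gage U\<close> unfolding gage_def by auto
    then show ?thesis using s t by (intro exI[of _ u]) auto
  qed
  then show "(x, z) \<in> chain_rel m U f" unfolding chain_rel_def by blast
qed

end

section \<open>Gages\<close>

lemma gageD: "d \<in> gage U \<Longrightarrow> pseudometric d"
  unfolding gage_def by blast

lemma gage_le:
  assumes "d \<in> gage U" "pseudometric d'" "\<And>x y. d' x y \<le> d x y"
  shows "d' \<in> gage U"
proof -
  have "eventually (\<lambda>(x, y). d' x y < \<epsilon>) U" if "\<epsilon> > 0" for \<epsilon>
  proof -
    have "eventually (\<lambda>(x, y). d x y < \<epsilon>) U"
      using assms(1) that unfolding gage_def by blast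
    then show ?thesis
      by (rule eventually_mono) (use assms(3) in \<open>auto intro: le_less_trans\<close>)
  qed
  moreover have "\<exists>B. \<forall>x y. d' x y \<le> B"
    using assms(1,3) unfolding gage_def by (blast intro: order_trans)
  ultimately show ?thesis
    using assms(2) unfolding gage_def by blast
qed

lemma gage_max:
  assumes d: "d \<in> gage U" and d': "d' \<in> gage U"
  shows "(\<lambda>x y. max (d x y) (d' x y)) \<in> gage U"
proof -
  have "pseudometric (\<lambda>x y. max (d x y) (d' x y))"
    unfolding pseudometric_def
  proof (intro conjI allI)
    show "max (d x z) (d' x z) \<le> max (d x y) (d' x y) + max (d y z) (d' y z)" for x y z
      using pseudometricD(4)[OF gageD[OF d], of x z y] pseudometricD(4)[OF gageD[OF d'], of x z y]
      by linarith
    show "max (d x y) (d' x y) = max (d y x) (d' y x)" for x y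
      using pseudometricD(3)[OF gageD[OF d], of x y] pseudometricD(3)[OF gageD[OF d'], of x y] by simp
  qed (use pseudometricD(1,2)[OF gageD[OF d]] pseudometricD(1,2)[OF gageD[OF d']]
      in \<open>simp_all add: le_max_iff_disj\<close>)
  moreover obtain B B' where "\<And>x y. d x y \<le> B" "\<And>x y. d' x y \<le> B'"
    using d d' unfolding gage_def by blast
  then have "max (d x y) (d' x y) \<le> max B B'" for x y
    by (rule max.mono)
  moreover have "eventually (\<lambda>(x, y). max (d x y) (d' x y) < \<epsilon>) U" if "\<epsilon> > 0" for \<epsilon>
  proof -
    have "eventually (\<lambda>(x, y). d x y < \<epsilon>) U" "eventually (\<lambda>(x, y). d' x y < \<epsilon>) U"
      using d d' that unfolding gage_def by blast+
    then show ?thesis by eventually_elim auto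
  qed
  ultimately show ?thesis unfolding gage_def by blast
qed

section \<open>Pseudo-metrics obtained as infima of chain costs\<close>

definition chain_hemimetric ::
  "(real \<Rightarrow> real \<Rightarrow> real) \<Rightarrow> 'a rel \<Rightarrow> ('a \<Rightarrow> 'a \<Rightarrow> real) \<Rightarrow> 'a \<Rightarrow> 'a \<Rightarrow> real" where
  "chain_hemimetric m f d x y = Inf (insert (d x y) {t. chain_cost m f d y x t})"

definition chain_metric ::
  "(real \<Rightarrow> real \<Rightarrow> real) \<Rightarrow> 'a rel \<Rightarrow> ('a \<Rightarrow> 'a \<Rightarrow> real) \<Rightarrow> 'a \<Rightarrow> 'a \<Rightarrow> real" where
  "chain_metric m f d x y = max (chain_hemimetric m f d x y) (chain_hemimetric m f d y x)"

context chain_op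
begin

lemma bdd_below_chain_cost:
  "pseudometric d \<Longrightarrow> bdd_below (insert (d x y) {t. chain_cost m f d y x t})"
  by (rule bdd_belowI[of _ 0]) (auto simp: pseudometricD(1) dest: chain_cost_nonneg)

text \<open>The alternative \<open>d x y < \<epsilon>\<close> comes from the inserted value
  \<open>d x y\<close>, which counts as a chain without links. It keeps the infimum at most
  \<open>d\<close>, and zero on the diagonal, even where no chain exists.\<close>

lemma chain_hemimetric_less_iff:
  "pseudometric d \<Longrightarrow> chain_hemimetric m f d x y < \<epsilon> \<longleftrightarrow>
     d x y < \<epsilon> \<or> (\<exists>t<\<epsilon>. chain_cost m f d y x t)"
  unfolding chain_hemimetric_def by (subst cInf_less_iff[OF _ bdd_below_chain_cost]) auto

lemma chain_hemimetric_nonneg: "pseudometric d \<Longrightarrow> 0 \<le> chain_hemimetric m f d x y"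
  unfolding chain_hemimetric_def
  by (rule cInf_greatest) (auto simp: pseudometricD(1) dest: chain_cost_nonneg)

lemma chain_hemimetric_le: "pseudometric d \<Longrightarrow> chain_hemimetric m f d x y \<le> d x y"
  unfolding chain_hemimetric_def by (rule cInf_lower[OF insertI1 bdd_below_chain_cost])

text \<open>Each leg is a direct step or a chain, up to \<open>e/2\<close>. Two direct steps use the
  triangle inequality of \<open>d\<close>, a direct step beside a chain moves an endpoint of that
  chain, and two chains are joined.\<close>

lemma chain_hemimetric_triangle:
  assumes d: "pseudometric d"
  shows "chain_hemimetric m f d x z \<le> chain_hemimetric m f d x y + chain_hemimetric m f d y z"
proof (rule field_le_epsilon)
  let ?h = "chain_hemimetric m f d"
  fix e :: real assume "0 < e"
  define \<alpha> \<beta> where "\<alpha> = ?h x y + e/2" and "\<beta> = ?h y z + e/2"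
  have xy: "d x y < \<alpha> \<or> (\<exists>t<\<alpha>. chain_cost m f d y x t)"
    and yz: "d y z < \<beta> \<or> (\<exists>t<\<beta>. chain_cost m f d z y t)"
    using chain_hemimetric_less_iff[OF d] \<open>0 < e\<close> unfolding \<alpha>_def \<beta>_def
    by (metis less_add_same_cancel1 half_gt_zero)+
  have "d x z < \<alpha> + \<beta> \<or> (\<exists>u<\<alpha> + \<beta>. chain_cost m f d z x u)"
    using xy
  proof
    assume xy: "d x y < \<alpha>"
    from yz show ?thesis
    proof
      assume "d y z < \<beta>"
      then show ?thesis using xy pseudometricD(4)[OF d, of x z y] by linarith
    next
      assume "\<exists>t<\<beta>. chain_cost m f d z y t"
      then obtain t u where "t < \<beta>" "u \<le> d x y + t" "chain_cost m f d z x u"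
        using chain_cost_change_start[OF d] by meson
      with xy have "u < \<alpha> + \<beta>" by linarith
      with \<open>chain_cost m f d z x u\<close> show ?thesis by blast
    qed
  next
    assume "\<exists>t<\<alpha>. chain_cost m f d y x t"
    then obtain s where s: "s < \<alpha>" "chain_cost m f d y x s" by blast
    from yz show ?thesis
    proof
      assume yz: "d y z < \<beta>"
      obtain u where "u \<le> s + d y z" "chain_cost m f d z x u"
        using chain_cost_change_end[OF d s(2)] by blast
      moreover from this s yz have "u < \<alpha> + \<beta>" by linarith
      ultimately show ?thesis by blast
    next
      assume "\<exists>t<\<beta>. chain_cost m f d z y t"
      then obtain t where t: "t < \<beta>" "chain_cost m f d z y t" by blast
      obtain u where "u \<le> s + t" "chain_cost m f d z x u"
        using chain_cost_trans[OF d s(2) t(2)] by blast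
      moreover from this s t have "u < \<alpha> + \<beta>" by linarith
      ultimately show ?thesis by blast
    qed
  qed
  then have "?h x z < \<alpha> + \<beta>"
    using chain_hemimetric_less_iff[OF d] by blast
  then show "?h x z \<le> ?h x y + ?h y z + e"
    by (simp add: \<alpha>_def \<beta>_def)
qed

text \<open>Boundedness and uniform continuity are inherited from \<open>d\<close>, which dominates
  the symmetrized infimum; only the pseudo-metric axioms have to be checked.\<close>

lemma chain_metric_in_gage:
  assumes d: "d \<in> gage U"
  shows "chain_metric m f d \<in> gage U"
proof (rule gage_le[OF d])
  note p = gageD[OF d]
  have refl: "chain_hemimetric m f d x x = 0" for x
    using chain_hemimetric_nonneg[OF p, of f x x] chain_hemimetric_le[OF p, of f x x]
      pseudometricD(2)[OF p, of x] by linarith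
  have tri: "chain_metric m f d x z \<le> chain_metric m f d x y + chain_metric m f d y z" for x y z
    using chain_hemimetric_triangle[OF p, of f x z y] chain_hemimetric_triangle[OF p, of f z x y]
    unfolding chain_metric_def by linarith
  show "pseudometric (chain_metric m f d)"
    unfolding pseudometric_def
  proof (intro conjI allI)
    show "chain_metric m f d x z \<le> chain_metric m f d x y + chain_metric m f d y z" for x y z
      by (rule tri)
  qed (auto simp: chain_metric_def refl chain_hemimetric_nonneg[OF p] max.commute le_max_iff_disj)
  show "chain_metric m f d x y \<le> d x y" for x y
    using chain_hemimetric_le[OF p, of f x y] chain_hemimetric_le[OF p, of f y x]
      pseudometricD(3)[OF p, of x y]
    unfolding chain_metric_def by simp
qed

lemma chain_rel_imp_hemimetric_eq_0:
  assumes "(x, y) \<in> chain_rel m U f" and d: "d \<in> gage U"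
  shows "chain_hemimetric m f d x y = 0"
proof (rule ccontr)
  assume "chain_hemimetric m f d x y \<noteq> 0"
  then have "chain_hemimetric m f d x y > 0"
    using chain_hemimetric_nonneg[OF gageD[OF d], of f x y] by linarith
  then have "\<exists>t<chain_hemimetric m f d x y. chain_cost m f d y x t"
    by (rule chain_relD[OF assms])
  then have "chain_hemimetric m f d x y < chain_hemimetric m f d x y"
    using chain_hemimetric_less_iff[OF gageD[OF d]] by blast
  then show False by simp
qed

lemma hemimetric_pos_of_not_chain_rel:
  assumes sep: "\<And>x y. x \<noteq> y \<Longrightarrow> \<exists>d\<in>gage U. 0 < d x y"
    and "x \<noteq> y" "(x, y) \<notin> chain_rel m U f"
  shows "\<exists>d\<in>gage U. 0 < chain_hemimetric m f d x y"
proof -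
  obtain d \<epsilon> where d: "d \<in> gage U" "0 < \<epsilon>" and no: "\<not> (\<exists>t<\<epsilon>. chain_cost m f d y x t)"
    using assms(3) unfolding chain_rel_def by blast
  obtain d' where d': "d' \<in> gage U" "0 < d' x y"
    using sep[OF assms(2)] by blast
  \<comment> \<open>One gage element must exclude both cheap chains and a short direct step:
    \<open>d\<close> does the former and \<open>d'\<close> the latter, so their maximum does
    both.\<close>
  let ?D = "\<lambda>x y. max (d x y) (d' x y)"
  have D: "?D \<in> gage U" by (rule gage_max[OF d(1) d'(1)])
  have "\<not> (\<exists>t<\<epsilon>. chain_cost m f ?D y x t)"
  proof
    assume "\<exists>t<\<epsilon>. chain_cost m f ?D y x t"
    then obtain t where "t < \<epsilon>" "chain_cost m f ?D y x t" by blast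
    moreover from chain_cost_mono[OF this(2), of d]
    obtain u where "u \<le> t" "chain_cost m f d y x u" by auto
    ultimately show False using no by (meson le_less_trans)
  qed
  then have "\<not> chain_hemimetric m f ?D x y < min \<epsilon> (d' x y)"
    by (subst chain_hemimetric_less_iff[OF gageD[OF D]]) auto
  then have "0 < chain_hemimetric m f ?D x y"
    using d d' by auto
  with D show ?thesis by blast
qed

text \<open>The diagonal has to be added because the pseudo-metrics vanish on it even at points that
  are not chain recurrent. Off the diagonal, a pair missing from the relation in one direction gives
  a positive value in that direction.\<close>

lemma chain_equivalence_eq:
  assumes sep: "\<And>x y. x \<noteq> y \<Longrightarrow> \<exists>d\<in>gage U. 0 < d x y"
  shows "Id \<union> (chain_rel m U f \<inter> (chain_rel m U f)\<inverse>) =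
    {(x, y). \<forall>p\<in>chain_metric m f ` gage U. p x y = 0}"
proof -
  have "chain_metric m f d x y = 0"
    if "x = y \<or> (x, y) \<in> chain_rel m U f \<and> (y, x) \<in> chain_rel m U f" and d: "d \<in> gage U" for x y d
    using that pseudometricD(2)[OF gageD[OF chain_metric_in_gage[OF d]], of f x]
    by (auto simp: chain_metric_def chain_rel_imp_hemimetric_eq_0)
  moreover have "x = y \<or> (x, y) \<in> chain_rel m U f \<and> (y, x) \<in> chain_rel m U f"
    if *: "\<forall>d\<in>gage U. chain_metric m f d x y = 0" for x y
  proof (rule ccontr)
    assume "\<not> ?thesis"
    then have "\<exists>d\<in>gage U. 0 < chain_hemimetric m f d x y \<or> 0 < chain_hemimetric m f d y x"
      using hemimetric_pos_of_not_chain_rel[OF sep, of x y f]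
        hemimetric_pos_of_not_chain_rel[OF sep, of y x f] by auto
    then show False
      using * unfolding chain_metric_def by (metis less_max_iff_disj less_irrefl)
  qed
  ultimately have "(x, y) \<in> Id \<union> (chain_rel m U f \<inter> (chain_rel m U f)\<inverse>) \<longleftrightarrow>
      (\<forall>d\<in>gage U. chain_metric m f d x y = 0)" for x y
    unfolding Un_iff Int_iff converse_iff pair_in_Id_conv by metis
  then show ?thesis by auto
qed

end

section \<open>Uniformly continuous functions from sequences of entourages\<close>

text \<open>For a sequence of relations with \<open>V (n + 1) O V (n + 1) \<subseteq> V n\<close>, the relation
  \<open>dyadic V n k\<close> depends only on \<open>k / 2 ^ n\<close> and grows with it. Below 1 it is the product of
  the \<open>V i\<close> over the positions \<open>i\<close> of the nonzero binary digits of that number.\<close>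

fun dyadic :: "(nat \<Rightarrow> 'a rel) \<Rightarrow> nat \<Rightarrow> nat \<Rightarrow> 'a rel" where
  "dyadic V 0 k = (if k = 0 then Id else UNIV)"
| "dyadic V (Suc n) k =
     (if even k then dyadic V n (k div 2) else dyadic V n (k div 2) O V (Suc n))"

lemma dyadic_scale: "dyadic V (n + i) (k * 2 ^ i) = dyadic V n k"
proof (induction i)
  case (Suc i)
  have "k * 2 ^ Suc i = 2 * (k * 2 ^ i)" by simp
  then have "dyadic V (n + Suc i) (k * 2 ^ Suc i) = dyadic V (n + i) (k * 2 ^ i)"
    by (simp only: add_Suc_right dyadic.simps) simp
  with Suc.IH show ?case by (simp only:)
qed simp

text \<open>For even \<open>k\<close> at a successor level the composition merely sets the last
  binary digit. For odd \<open>k\<close> there is a carry: the two factors \<open>V (Suc n)\<close>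
  combine into one \<open>V n\<close>, to which the induction hypothesis applies.\<close>

lemma dyadic_relcomp:
  assumes "\<And>n. V (Suc n) O V (Suc n) \<subseteq> V n"
  shows "dyadic V n k O V n \<subseteq> dyadic V n (Suc k)"
proof (induction n arbitrary: k)
  case (Suc n)
  have "(dyadic V n j O V (Suc n)) O V (Suc n) \<subseteq> dyadic V n (Suc j)" for j
    using relcomp_mono[OF order_refl assms[of n], of "dyadic V n j"] Suc.IH[of j]
    unfolding O_assoc by (rule order_trans)
  then show ?case
    by (cases "even k") (simp_all add: odd_Suc_div_two)
qed auto

lemma dyadic_mono:
  assumes V: "\<And>n. V (Suc n) O V (Suc n) \<subseteq> V n" and Id: "\<And>n. Id \<subseteq> V n" and "k \<le> l"
  shows "dyadic V n k \<subseteq> dyadic V n l"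
proof (rule lift_Suc_mono_le[OF _ \<open>k \<le> l\<close>])
  fix k
  have "dyadic V n k O Id \<subseteq> dyadic V n k O V n"
    by (rule relcomp_mono[OF order_refl Id])
  then show "dyadic V n k \<subseteq> dyadic V n (Suc k)"
    using dyadic_relcomp[where V=V, OF V, of n k] by simp
qed

text \<open>The hypothesis is \<open>k / 2 ^ m \<le> l / 2 ^ n\<close> without denominators; both
  sides are compared at the common level \<open>m + n\<close>.\<close>

lemma dyadic_coarsen:
  assumes "\<And>n. V (Suc n) O V (Suc n) \<subseteq> V n" "\<And>n. Id \<subseteq> V n" and le: "k * 2 ^ n \<le> l * 2 ^ m"
  shows "dyadic V m k \<subseteq> dyadic V n l"
proof -
  have "dyadic V m k = dyadic V (m + n) (k * 2 ^ n)"
    by (rule dyadic_scale[symmetric])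
  also have "\<dots> \<subseteq> dyadic V (n + m) (l * 2 ^ m)"
    unfolding add.commute[of m n] by (rule dyadic_mono[where V=V, OF assms])
  finally show ?thesis by (simp only: dyadic_scale)
qed

text \<open>This is the Urysohn construction for entourages: \<open>g z\<close> is the infimum of
  the dyadic numbers whose relation links \<open>x\<close> to \<open>z\<close>.\<close>

lemma dyadic_function_exists:
  assumes V: "\<And>n. V (Suc n) O V (Suc n) \<subseteq> V n" "\<And>n. Id \<subseteq> V n" and xy: "(x, y) \<notin> V 1"
  shows "\<exists>g :: 'a \<Rightarrow> real. (\<forall>z. 0 \<le> g z \<and> g z \<le> 1) \<and> g x \<noteq> g y \<and>
    (\<forall>n u v. (u, v) \<in> V n \<longrightarrow> g v \<le> g u + 2 / 2 ^ n)"
proof -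
  define G where "G z = {real k / 2 ^ n | k n. (x, z) \<in> dyadic V n k}" for z
  define g where "g z = Inf (G z)" for z
  have bdd: "bdd_below (G z)" for z
    by (rule bdd_belowI[of _ 0]) (auto simp: G_def)
  have one: "1 \<in> G z" for z
    unfolding G_def by (intro CollectI exI[of _ 1] exI[of _ 0]) (simp add: exI[of _ 0])
  have le: "g z \<le> real k / 2 ^ n" if "(x, z) \<in> dyadic V n k" for z k n
    unfolding g_def using that by (intro cInf_lower bdd) (auto simp: G_def)
  have ge: "c \<le> g z" if "\<And>k n. (x, z) \<in> dyadic V n k \<Longrightarrow> c \<le> real k / 2 ^ n" for c z
    unfolding g_def
  proof (rule cInf_greatest)
    show "G z \<noteq> {}" using one[of z] by auto
    show "c \<le> t" if "t \<in> G z" for t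
      using that \<open>\<And>k n. (x, z) \<in> dyadic V n k \<Longrightarrow> c \<le> real k / 2 ^ n\<close> unfolding G_def by auto
  qed
  have "0 \<le> g z" for z by (rule ge) simp
  moreover have "g z \<le> 1" for z unfolding g_def by (rule cInf_lower[OF one bdd])
  moreover have "g x \<le> 0" using le[of x 0 0] by simp
  moreover have "1 / 2 \<le> g y"
  \<comment> \<open>The bound 1/2 corresponds to \<open>dyadic V 1 1\<close>, which is
    \<open>V 1\<close>: a smaller dyadic number linking \<open>x\<close> to \<open>y\<close> would
    put \<open>(x, y)\<close> into \<open>V 1\<close>.\<close>
  proof (rule ge, rule ccontr)
    fix k n assume kn: "(x, y) \<in> dyadic V n k" and "\<not> 1 / 2 \<le> real k / 2 ^ n"
    then have "real (k * 2 ^ 1) \<le> real (1 * 2 ^ n)" by (simp add: field_simps)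
    then have "k * 2 ^ 1 \<le> 1 * 2 ^ n" by (simp only: of_nat_le_iff)
    from dyadic_coarsen[where V=V, OF V this] kn show False using xy by auto
  qed
  moreover have "g v \<le> g u + 2 / 2 ^ n" if uv: "(u, v) \<in> V n" for n u v
  proof -
    have "g v - 2 / 2 ^ n \<le> g u"
    proof (rule ge)
      fix k m assume km: "(x, u) \<in> dyadic V m k"
      \<comment> \<open>Here \<open>l / 2 ^ n\<close> is \<open>k / 2 ^ m\<close> rounded up to
        level \<open>n\<close>. Rounding costs at most \<open>1 / 2 ^ n\<close> and composing with
        \<open>V n\<close> the same again, whence the constant 2.\<close>
      define l where "l = Suc (k * 2 ^ n div 2 ^ m)"
      have "k * 2 ^ n \<le> l * 2 ^ m"
        using dividend_less_times_div[of "2 ^ m" "k * 2 ^ n"] unfolding l_def by (simp add: mult.commute)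
      from dyadic_coarsen[where V=V, OF V this] km uv have "(x, v) \<in> dyadic V n (Suc l)"
        using dyadic_relcomp[where V=V, OF V(1), of n l] by auto
      then have "g v \<le> real (Suc l) / 2 ^ n" by (rule le)
      also have "real (Suc l) \<le> real k * 2 ^ n / 2 ^ m + 2"
        using of_nat_div_le_of_nat[of "k * 2 ^ n" "2 ^ m", where ?'a = real]
        unfolding l_def by simp
      finally have "g v \<le> (real k * 2 ^ n / 2 ^ m + 2) / 2 ^ n"
        by (simp add: divide_right_mono)
      then show "g v - 2 / 2 ^ n \<le> real k / 2 ^ m" by (simp add: field_simps)
    qed
    then show ?thesis by simp
  qed
  ultimately show ?thesis by (intro exI[of _ g]) force
qed

text \<open>An entourage without \<open>(x, y)\<close> is refined repeatedly by composition square
  roots. The resulting bounded function \<open>g\<close> is uniformly continuous, so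
  \<open>\<bar>g u - g v\<bar>\<close> is a gage element.\<close>

lemma gage_uniformity_separates:
  fixes x y :: "'a :: {uniform_space, t2_space}"
  assumes "x \<noteq> y"
  shows "\<exists>d\<in>gage uniformity. 0 < d x y"
proof -
  obtain U where U: "open U" "x \<in> U" "y \<notin> U"
    using t1_space[OF assms] by auto
  have "eventually (\<lambda>z. z \<noteq> y) (nhds x)"
    by (rule eventually_mono[OF eventually_nhds_in_open[OF U(1,2)]]) (use U(3) in auto)
  then have E0: "eventually (\<lambda>(x', z). x' = x \<longrightarrow> z \<noteq> y) uniformity"
    by (simp only: eventually_nhds_uniformity)
  have "\<exists>W. \<forall>n. (eventually (W n) uniformity \<and> (n = 0 \<longrightarrow> \<not> W n (x, y))) \<and>
      (\<forall>a b c. W (Suc n) (a, b) \<longrightarrow> W (Suc n) (b, c) \<longrightarrow> W n (a, c))"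
  proof (rule dependent_nat_choice)
    show "\<exists>E. eventually E uniformity \<and> ((0::nat) = 0 \<longrightarrow> \<not> E (x, y))"
      by (rule exI, rule conjI, rule E0) simp
  next
    fix E and n :: nat assume "eventually E uniformity \<and> (n = 0 \<longrightarrow> \<not> E (x, y))"
    then obtain D where "eventually D uniformity" "\<And>a b c. D (a, b) \<Longrightarrow> D (b, c) \<Longrightarrow> E (a, c)"
      by (auto elim: uniformity_transE)
    then show "\<exists>D. (eventually D uniformity \<and> (Suc n = 0 \<longrightarrow> \<not> D (x, y))) \<and>
        (\<forall>a b c. D (a, b) \<longrightarrow> D (b, c) \<longrightarrow> E (a, c))"
      by (intro exI[of _ D]) simp
  qed
  then obtain W where W: "\<And>n. eventually (W n) uniformity" "\<not> W 0 (x, y)"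
    "\<And>n a b c. W (Suc n) (a, b) \<Longrightarrow> W (Suc n) (b, c) \<Longrightarrow> W n (a, c)"
    by metis
  \<comment> \<open>The shift by one makes \<open>V 1\<close> the entourage \<open>W 0\<close> that
    omits \<open>(x, y)\<close>, as \<open>dyadic_function_exists\<close> demands;
    \<open>V 0\<close> can then be everything.\<close>
  define V where "V n = (case n of 0 \<Rightarrow> UNIV | Suc n \<Rightarrow> {z. W n z})" for n
  have "V (Suc n) O V (Suc n) \<subseteq> V n" for n
    unfolding V_def using W(3) by (cases n) auto
  moreover have "Id \<subseteq> V n" for n
    unfolding V_def using uniformity_refl[OF W(1)] by (cases n) auto
  moreover have "(x, y) \<notin> V 1" unfolding V_def using W(2) by simp
  ultimately have "\<exists>g :: 'a \<Rightarrow> real. (\<forall>z. 0 \<le> g z \<and> g z \<le> 1) \<and> g x \<noteq> g y \<and>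
      (\<forall>n u v. (u, v) \<in> V n \<longrightarrow> g v \<le> g u + 2 / 2 ^ n)"
    by (rule dyadic_function_exists)
  then obtain g :: "'a \<Rightarrow> real" where "(\<forall>z. 0 \<le> g z \<and> g z \<le> 1) \<and> g x \<noteq> g y \<and>
      (\<forall>n u v. (u, v) \<in> V n \<longrightarrow> g v \<le> g u + 2 / 2 ^ n)" ..
  then have g: "0 \<le> g z" "g z \<le> 1" "g x \<noteq> g y"
    and uc: "(u, v) \<in> V n \<Longrightarrow> g v \<le> g u + 2 / 2 ^ n" for z u v n
    by simp_all
  let ?d = "\<lambda>u v. \<bar>g u - g v\<bar>"
  have "pseudometric ?d"
    unfolding pseudometric_def by auto
  moreover have "?d u v \<le> 1" for u v
    using g(1,2)[of u] g(1,2)[of v] by (simp add: abs_le_iff)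
  moreover have "eventually (\<lambda>(u, v). ?d u v < \<epsilon>) uniformity" if eps: "\<epsilon> > 0" for \<epsilon>
  proof -
    obtain n where n: "(1 / 2) ^ n < \<epsilon>"
      using real_arch_pow_inv[OF eps, of "1 / 2"] by auto
    \<comment> \<open>The entourages were not chosen symmetric, and the one-sided estimate on
      \<open>g\<close> is needed in both directions.\<close>
    have "eventually (\<lambda>(u, v). W n (u, v)) uniformity" "eventually (\<lambda>(u, v). W n (v, u)) uniformity"
      using W(1)[of n] uniformity_sym[OF W(1)[of n]] by simp_all
    then show ?thesis
    proof eventually_elim
      case (elim z)
      obtain u v where z: "z = (u, v)" by (cases z)
      have "(u, v) \<in> V (Suc n)" "(v, u) \<in> V (Suc n)"
        using elim unfolding V_def z by simp_all
      from uc[OF this(1)] uc[OF this(2)] have "?d u v \<le> (1 / 2) ^ n"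
        by (simp add: power_one_over abs_le_iff)
      then show ?case using n unfolding z by simp
    qed
  qed
  ultimately have "?d \<in> gage uniformity"
    unfolding gage_def by auto
  then show ?thesis by (rule bexI[rotated]) (use g(3) in simp)
qed

section \<open>Continuity of gage elements and their common zero sets\<close>

lemma gage_uniformity_tendsto:
  assumes d: "d \<in> gage (uniformity :: ('a :: uniform_space \<times> 'a) filter)"
  shows "(d a \<longlongrightarrow> 0) (nhds a)"
proof (rule tendstoI)
  fix \<epsilon> :: real assume "0 < \<epsilon>"
  then have "eventually (\<lambda>(x, y). d x y < \<epsilon>) uniformity"
    using d unfolding gage_def by simp
  then have "eventually (\<lambda>(x, y). x = a \<longrightarrow> d a y < \<epsilon>) uniformity"
    by (rule eventually_mono) auto
  then have "eventually (\<lambda>y. d a y < \<epsilon>) (nhds a)"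
    by (simp add: eventually_nhds_uniformity)
  then show "eventually (\<lambda>y. dist (d a y) 0 < \<epsilon>) (nhds a)"
    by (rule eventually_mono) (simp add: pseudometricD(1)[OF gageD[OF d]])
qed

lemma gage_uniformity_continuous:
  assumes d: "d \<in> gage (uniformity :: ('a :: uniform_space \<times> 'a) filter)"
  shows "continuous_on UNIV (\<lambda>z. d (fst z) (snd z))"
unfolding continuous_on_def
proof
  note p = pseudometricD[OF gageD[OF d]]
  fix z :: "'a \<times> 'a"
  have ab: "((\<lambda>w. d (fst z) (fst w) + d (snd z) (snd w)) \<longlongrightarrow> 0 + 0) (at z)"
    by (intro tendsto_add filterlim_compose[OF gage_uniformity_tendsto[OF d]] tendsto_fst tendsto_snd
        tendsto_ident_at)
  have le: "norm (d (fst w) (snd w) - d (fst z) (snd z)) \<le> d (fst z) (fst w) + d (snd z) (snd w)" for w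
    using p(4)[of "fst w" "snd w" "fst z"] p(4)[of "fst z" "snd w" "snd z"]
      p(4)[of "fst z" "snd z" "fst w"] p(4)[of "fst w" "snd z" "snd w"]
      p(3)[of "fst w" "fst z"] p(3)[of "snd w" "snd z"]
    by (simp add: abs_le_iff)
  have "((\<lambda>w. d (fst w) (snd w) - d (fst z) (snd z)) \<longlongrightarrow> 0) (at z)"
    by (rule Lim_null_comparison[OF always_eventually[OF allI[OF le]] ab[simplified]])
  then show "((\<lambda>w. d (fst w) (snd w)) \<longlongrightarrow> d (fst z) (snd z)) (at z)"
    by (rule LIM_zero_cancel)
qed

lemma gage_uniformity_continuous_right:
  assumes d: "d \<in> gage (uniformity :: ('a :: uniform_space \<times> 'a) filter)"
  shows "continuous_on UNIV (d a)"
  using continuous_on_compose2[OF gage_uniformity_continuous[OF d], of UNIV "\<lambda>y. (a, y)"]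
  by (simp add: continuous_on_Pair)

lemma equiv_zero_set_pseudometrics:
  assumes "\<And>p. p \<in> P \<Longrightarrow> pseudometric p"
  shows "equiv UNIV {(x, y). \<forall>p\<in>P. p x y = 0}"
proof (rule equivI)
  show "sym {(x, y). \<forall>p\<in>P. p x y = 0}"
    by (rule symI) (simp add: pseudometricD(3)[OF assms])
  show "trans {(x, y). \<forall>p\<in>P. p x y = 0}"
  proof (rule transI, clarify)
    fix x y z p assume xy: "\<forall>p\<in>P. p x y = 0" and yz: "\<forall>p\<in>P. p y z = 0" and p: "p \<in> P"
    show "p x z = 0"
      using pseudometricD(4)[OF assms[OF p], of x z y] pseudometricD(1)[OF assms[OF p], of x z]
        bspec[OF xy p] bspec[OF yz p] by linarith
  qed
qed (auto simp: refl_on_def pseudometricD(2)[OF assms])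

lemma closed_zero_set_gage:
  assumes "P \<subseteq> gage (uniformity :: ('a :: uniform_space \<times> 'a) filter)"
  shows "closed {(x, y). \<forall>p\<in>P. p x y = 0}"
proof -
  have "{(x, y). \<forall>p\<in>P. p x y = 0} = (\<Inter>p\<in>P. {z. p (fst z) (snd z) = 0})" by auto
  moreover have "closed \<dots>"
    using assms by (intro closed_INT ballI closed_Collect_eq gage_uniformity_continuous continuous_on_const) auto
  ultimately show ?thesis by simp
qed

section \<open>Separation of points in quotients\<close>

lemma quotient_topology_class_cases:
  assumes "w \<in> topspace (quotient_topology X r)"
  obtains x where "x \<in> topspace X" "w = r `` {x}"
  using assms unfolding topspace_quotient_topology by (rule quotientE)

text \<open>If \<open>p\<close> is nonzero on a pair of representatives, the bounded continuous
  function \<open>p x\<close> is constant on classes by the triangle inequality, so it descends and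
  distinguishes the two classes.\<close>

lemma completely_Hausdorff_quotient_gage:
  assumes P: "P \<subseteq> gage (uniformity :: ('a :: uniform_space \<times> 'a) filter)"
    and E: "E = {(x, y). \<forall>p\<in>P. p x y = 0}"
  shows "completely_Hausdorff_space (quotient_topology euclidean E)"
  unfolding completely_Hausdorff_space_def
proof (intro ballI impI)
  have ps: "pseudometric p" if "p \<in> P" for p
    using P that by (auto dest: gageD)
  have eq: "equiv UNIV E"
    unfolding E by (rule equiv_zero_set_pseudometrics[OF ps])
  let ?Q = "quotient_topology (euclidean :: 'a topology) E"
  fix v w assume vw: "v \<in> topspace ?Q" "w \<in> topspace ?Q" "v \<noteq> w"
  obtain x where x: "v = E `` {x}" by (rule quotient_topology_class_cases[OF vw(1)])
  obtain y where y: "w = E `` {y}" by (rule quotient_topology_class_cases[OF vw(2)])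
  have "(x, y) \<notin> E" using vw(3) x y equiv_class_eq[OF eq] by auto
  then obtain p where p: "p \<in> P" "p x y \<noteq> 0" unfolding E by auto
  have pg: "p \<in> gage uniformity" using P p by auto
  have cont: "continuous_map euclidean euclideanreal (p x)"
    using gage_uniformity_continuous_right[OF pg] by simp
  have resp: "p x a = p x b" if "E `` {a} = E `` {b}" for a b
  proof -
    have "(a, b) \<in> E" using eq_equiv_class[OF that eq] by simp
    then have "p a b = 0" using p unfolding E by auto
    then show ?thesis
      using pseudometricD(4)[OF ps[OF p(1)], of x a b] pseudometricD(4)[OF ps[OF p(1)], of x b a]
        pseudometricD(3)[OF ps[OF p(1)], of a b] by simp
  qed
  obtain g where g: "continuous_map ?Q euclideanreal g" "g ` topspace ?Q = p x ` topspace euclidean"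
    "\<And>a. a \<in> topspace euclidean \<Longrightarrow> g (E `` {a}) = p x a"
    using quotient_map_lift_exists[OF quotient_map_quotient_topology cont] resp by metis
  obtain B where "\<And>a b. p a b \<le> B" using pg unfolding gage_def by auto
  then have "bounded (p x ` UNIV)"
    using pseudometricD(1)[OF ps[OF p(1)]] by (intro boundedI[of _ B]) auto
  moreover have "g v \<noteq> g w"
    using g(3)[of x] g(3)[of y] p(2) pseudometricD(2)[OF ps[OF p(1)], of x] x y by simp
  ultimately show "\<exists>g. continuous_map ?Q euclideanreal g \<and> bounded (g ` topspace ?Q) \<and> g v \<noteq> g w"
    using g(1,2) by (intro exI[of _ g]) simp
qed

lemma totally_disconnected_quotient:
  assumes eq: "equiv (topspace X) E"
    and sep: "\<And>x y. \<lbrakk>x \<in> topspace X; y \<in> topspace X; (x, y) \<notin> E\<rbrakk> \<Longrightarrow>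
      \<exists>W. closedin X W \<and> openin X W \<and> E `` W \<subseteq> W \<and> x \<in> W \<and> y \<notin> W"
  shows "totally_disconnected_space (quotient_topology X E)"
  unfolding totally_disconnected_space_def
proof (intro ballI)
  let ?Q = "quotient_topology X E"
  fix v assume v: "v \<in> topspace ?Q"
  obtain x where x: "x \<in> topspace X" "v = E `` {x}" by (rule quotient_topology_class_cases[OF v])
  have "\<exists>W. closedin ?Q W \<and> openin ?Q W \<and> v \<in> W \<and> w \<notin> W" if w: "w \<noteq> v" for w
  proof (cases "w \<in> topspace ?Q")
    case False
    then show ?thesis using v by (intro exI[of _ "topspace ?Q"]) simp
  next
    case True
    obtain y where y: "y \<in> topspace X" "w = E `` {y}" by (rule quotient_topology_class_cases[OF True])
    have "(x, y) \<notin> E" using w x y equiv_class_eq[OF eq] by auto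
    then obtain W where W: "closedin X W" "openin X W" "E `` W \<subseteq> W" "x \<in> W" "y \<notin> W"
      using sep[OF x(1) y(1)] by auto
    have self: "a \<in> E `` {a}" if "a \<in> topspace X" for a
      using eq that by (rule equiv_class_self)
    \<comment> \<open>As \<open>W\<close> is saturated, a class lies inside \<open>W\<close> exactly
      when its representative belongs to \<open>W\<close>. The preimage of this set of classes is
      thus \<open>W\<close> itself, and clopenness passes to the quotient.\<close>
    have pre: "{a \<in> topspace X. E `` {a} \<in> {u \<in> topspace ?Q. u \<subseteq> W}} = W"
      using W(3) self closedin_subset[OF W(1)]
      by (auto simp: topspace_quotient_topology quotientI)
    have "openin ?Q {u \<in> topspace ?Q. u \<subseteq> W}"
      unfolding openin_quotient_topology pre using W(2) by (auto simp: topspace_quotient_topology)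
    moreover have "closedin ?Q {u \<in> topspace ?Q. u \<subseteq> W}"
      using quotient_map_quotient_topology[unfolded quotient_map_closedin, THEN conjunct2, rule_format,
          of "{u \<in> topspace ?Q. u \<subseteq> W}" X E] pre W(1) by simp
    moreover have "v \<subseteq> W" using W(3,4) x(2) by auto
    moreover have "\<not> w \<subseteq> W" using W(5) y self by auto
    ultimately show ?thesis using v by (intro exI[of _ "{u \<in> topspace ?Q. u \<subseteq> W}"]) simp
  qed
  then show "\<Inter> {W. closedin ?Q W \<and> openin ?Q W \<and> v \<in> W} = {v}"
    by auto
qed

section \<open>The Conley recurrent set\<close>

lemma open_gage_ball:
  assumes d: "d \<in> gage (uniformity :: ('a :: uniform_space \<times> 'a) filter)"
  shows "open {y. d x y < \<epsilon>}"
  using open_Collect_less[OF gage_uniformity_continuous_right[OF d] continuous_on_const] by simp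

text \<open>No jump shorter than the fixed \<epsilon> leaves \<open>W\<close> within
  \<open>Z\<close>, and by symmetry of \<open>d\<close> none leaves the complement, so both sets are
  relatively open.\<close>

lemma clopen_of_gage_invariant:
  assumes d: "d \<in> gage (uniformity :: ('a :: uniform_space \<times> 'a) filter)" and "\<epsilon> > 0"
    and step: "\<And>z z'. \<lbrakk>z \<in> Z; z' \<in> Z; d z z' < \<epsilon>; z \<in> W\<rbrakk> \<Longrightarrow> z' \<in> W" and "W \<subseteq> Z"
  shows "openin (top_of_set Z) W" "closedin (top_of_set Z) W"
proof -
  note p = pseudometricD[OF gageD[OF d]]
  have op: "openin (top_of_set Z) W'"
    if W': "\<And>z z'. \<lbrakk>z \<in> Z; z' \<in> Z; d z z' < \<epsilon>; z \<in> W'\<rbrakk> \<Longrightarrow> z' \<in> W'" "W' \<subseteq> Z" for W'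
  proof -
    have "W' = Z \<inter> (\<Union>z\<in>W'. {z'. d z z' < \<epsilon>})"
    proof
      show "W' \<subseteq> Z \<inter> (\<Union>z\<in>W'. {z'. d z z' < \<epsilon>})"
        using \<open>W' \<subseteq> Z\<close> \<open>\<epsilon> > 0\<close> by (auto intro!: bexI simp: p(2))
      show "Z \<inter> (\<Union>z\<in>W'. {z'. d z z' < \<epsilon>}) \<subseteq> W'"
      proof
        fix z' assume "z' \<in> Z \<inter> (\<Union>z\<in>W'. {z'. d z z' < \<epsilon>})"
        then obtain z where "z' \<in> Z" "z \<in> W'" "d z z' < \<epsilon>" by auto
        then show "z' \<in> W'" using W'(1)[of z z'] W'(2) by auto
      qed
    qed
    moreover have "open (\<Union>z\<in>W'. {z'. d z z' < \<epsilon>})"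
      by (intro open_UN ballI open_gage_ball[OF d])
    ultimately show ?thesis
      using openin_open_Int by metis
  qed
  show "openin (top_of_set Z) W"
    by (rule op) (use step \<open>W \<subseteq> Z\<close> in auto)
  have "openin (top_of_set Z) (Z - W)"
  proof (rule op)
    show "z' \<in> Z - W" if "z \<in> Z" "z' \<in> Z" "d z z' < \<epsilon>" "z \<in> Z - W" for z z'
      using step[of z' z] that p(3)[of z z'] by auto
  qed simp
  then show "closedin (top_of_set Z) W"
    using \<open>W \<subseteq> Z\<close> by (simp add: closedin_def)
qed

text \<open>Moving the end directly could raise the cost from \<open>s\<close> to
  \<open>s + d z z'\<close>, beyond \<epsilon>. After a cheap loop at \<open>z\<close>, the
  displacement is added to a small last gap instead, and the maximum does not add up the costs of
  the two pieces.\<close>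

lemma chain_cost_max_extend_by_loop:
  assumes d: "d \<in> gage U" and loop: "(z, z) \<in> chain_rel max U f"
    and xz: "chain_cost max f d z x s" and "s < \<epsilon>" and "d z z' < \<epsilon> / 2"
  shows "\<exists>t<\<epsilon>. chain_cost max f d z' x t"
proof -
  interpret chain_op max by (rule chain_op_max)
  note p = gageD[OF d]
  have "0 < \<epsilon>" using pseudometricD(1)[OF p, of z z'] \<open>d z z' < \<epsilon> / 2\<close> by linarith
  \<comment> \<open>The bound \<open>\<epsilon> - s\<close> pays for joining the loop to the chain;
    \<open>\<epsilon> / 2\<close> leaves room for \<open>d z z'\<close> at the end of the
    loop.\<close>
  then have pos: "0 < min (\<epsilon> - s) (\<epsilon> / 2)" using \<open>s < \<epsilon>\<close> by simp
  obtain t where t: "t < min (\<epsilon> - s) (\<epsilon> / 2)" and "chain_cost max f d z z t"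
    using chain_relD[OF loop d pos] by (elim exE conjE)
  from this(2) show ?thesis
  proof cases
    case (single a b)
    obtain u where u: "u \<le> s + d z a" "chain_cost max f d a x u"
      using chain_cost_change_end[OF p xz, of a] by auto
    have "d b z' \<le> d b z + d z z'" by (rule pseudometricD(4)[OF p])
    then have "max u (d b z') < \<epsilon>"
      using u(1) t single(1) \<open>d z z' < \<epsilon> / 2\<close> by linarith
    then show ?thesis
      using chain_cost_append(1)[OF u(2) single(2), of z'] by (intro exI conjI)
  next
    case (step a b t')
    obtain u where u: "u \<le> s + d z a" "chain_cost max f d a x u"
      using chain_cost_change_end[OF p xz, of a] by auto
    obtain v where v: "v \<le> t' + d z z'" "chain_cost max f d z' b v"
      using chain_cost_change_end[OF p step(3), of z'] by auto
    have "max u v < \<epsilon>"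
      using u(1) v(1) t step(1) \<open>d z z' < \<epsilon> / 2\<close> by linarith
    then show ?thesis
      using chain_cost_append(2)[OF u(2) step(2) v(2)] by (intro exI conjI)
  qed
qed

text \<open>The admissible jump \<open>\<epsilon> / 2\<close> is the same at every point of
  \<open>W\<close>, which gives clopenness. Saturation uses the slack \<open>\<epsilon> - s\<close>
  left by the strict bound.\<close>

lemma conley_chain_set_clopen:
  fixes f :: "('a :: uniform_space) rel" and x :: 'a
  defines "C \<equiv> chain_rel max uniformity f"
  assumes d: "d \<in> gage uniformity" and "\<epsilon> > 0"
  defines "W \<equiv> {z \<in> fixed_set C. \<exists>t<\<epsilon>. chain_cost max f d z x t}"
  shows "openin (top_of_set (fixed_set C)) W" "closedin (top_of_set (fixed_set C)) W"
    and "\<lbrakk>z \<in> W; w \<in> fixed_set C; (z, w) \<in> C\<rbrakk> \<Longrightarrow> w \<in> W"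
proof -
  interpret chain_op max by (rule chain_op_max)
  have step: "z' \<in> W" if "z \<in> fixed_set C" "z' \<in> fixed_set C" "d z z' < \<epsilon> / 2" "z \<in> W" for z z'
  proof -
    obtain s where "s < \<epsilon>" "chain_cost max f d z x s" using \<open>z \<in> W\<close> unfolding W_def by auto
    then have "\<exists>t<\<epsilon>. chain_cost max f d z' x t"
      using chain_cost_max_extend_by_loop[OF d, of z f x s \<epsilon> z'] that
      unfolding C_def fixed_set_def by simp
    then show ?thesis unfolding W_def using that(2) by simp
  qed
  have "0 < \<epsilon> / 2" "W \<subseteq> fixed_set C" using \<open>\<epsilon> > 0\<close> unfolding W_def by auto
  with step show "openin (top_of_set (fixed_set C)) W" "closedin (top_of_set (fixed_set C)) W"
    using clopen_of_gage_invariant[OF d, of "\<epsilon> / 2" "fixed_set C" W] by auto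
  assume z: "z \<in> W" and w: "w \<in> fixed_set C" and zw: "(z, w) \<in> C"
  obtain s where s: "s < \<epsilon>" "chain_cost max f d z x s" using z unfolding W_def by auto
  then have pos: "0 < \<epsilon> - s" by simp
  obtain t where t: "t < \<epsilon> - s" "chain_cost max f d w z t"
    using chain_relD[OF zw[unfolded C_def] d pos] by (elim exE conjE)
  obtain u where "u \<le> s + t" "chain_cost max f d w x u"
    using chain_cost_trans[OF gageD[OF d] s(2) t(2)] by auto
  then have "\<exists>t<\<epsilon>. chain_cost max f d w x t"
    using t(1) by (intro exI[of _ u]) simp
  then show "w \<in> W" unfolding W_def using w by simp
qed

text \<open>Going from a point to a related one and back shows by transitivity that both are fixed,
  so the symmetric part lives on the fixed set.\<close>

lemma equiv_fixed_set:
  assumes "trans R"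
  shows "equiv (fixed_set R) (R \<inter> R\<inverse>)"
proof (rule equivI)
  show "R \<inter> R\<inverse> \<subseteq> fixed_set R \<times> fixed_set R"
    using assms unfolding fixed_set_def by (auto dest: transD)
  show "trans (R \<inter> R\<inverse>)"
    using assms unfolding trans_def by blast
qed (auto simp: refl_on_def fixed_set_def sym_def)

lemma conley_quotient_totally_disconnected:
  fixes f :: "('a :: uniform_space) rel"
  defines "C \<equiv> chain_rel max uniformity f"
  shows "totally_disconnected_space (quotient_topology (top_of_set (fixed_set C)) (C \<inter> C\<inverse>))"
proof (rule totally_disconnected_quotient)
  interpret chain_op max by (rule chain_op_max)
  have tr: "trans C" unfolding C_def by (rule trans_chain_rel)
  then show "equiv (topspace (top_of_set (fixed_set C))) (C \<inter> C\<inverse>)"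
    by (simp add: equiv_fixed_set)
  have fixed: "a \<in> fixed_set C" "b \<in> fixed_set C" if "(a, b) \<in> C" "(b, a) \<in> C" for a b
    using transD[OF tr that] transD[OF tr that(2,1)] unfolding fixed_set_def by simp_all
  have separate: "\<exists>W. closedin (top_of_set (fixed_set C)) W \<and> openin (top_of_set (fixed_set C)) W \<and>
      (\<forall>z w. z \<in> W \<longrightarrow> w \<in> fixed_set C \<longrightarrow> (z, w) \<in> C \<longrightarrow> w \<in> W) \<and> x \<in> W \<and> y \<notin> W"
    if x: "x \<in> fixed_set C" and xy: "(x, y) \<notin> C" for x y
  proof -
    obtain d \<epsilon> where d: "d \<in> gage uniformity" "\<epsilon> > 0" and no: "\<not> (\<exists>t<\<epsilon>. chain_cost max f d y x t)"
      using xy unfolding C_def chain_rel_def by auto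
    let ?W = "{z \<in> fixed_set C. \<exists>t<\<epsilon>. chain_cost max f d z x t}"
    have "(x, x) \<in> chain_rel max uniformity f"
      using x unfolding C_def fixed_set_def by simp
    from chain_relD[OF this d] have "x \<in> ?W" using x by simp
    moreover have "y \<notin> ?W" using no by simp
    ultimately show ?thesis
      using conley_chain_set_clopen[OF d, where f = f and x = x, folded C_def] by (intro exI[of _ ?W]) simp
  qed
  fix x y assume xy: "x \<in> topspace (top_of_set (fixed_set C))" "y \<in> topspace (top_of_set (fixed_set C))"
    "(x, y) \<notin> C \<inter> C\<inverse>"
  then consider "(x, y) \<notin> C" | "(y, x) \<notin> C" by auto
  then show "\<exists>W. closedin (top_of_set (fixed_set C)) W \<and> openin (top_of_set (fixed_set C)) W \<and>
      (C \<inter> C\<inverse>) `` W \<subseteq> W \<and> x \<in> W \<and> y \<notin> W"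
  proof cases
    case 1
    obtain W where W: "closedin (top_of_set (fixed_set C)) W" "openin (top_of_set (fixed_set C)) W"
      "\<And>z w. \<lbrakk>z \<in> W; w \<in> fixed_set C; (z, w) \<in> C\<rbrakk> \<Longrightarrow> w \<in> W" "x \<in> W" "y \<notin> W"
      using separate[OF _ 1] xy(1) by auto
    have "(C \<inter> C\<inverse>) `` W \<subseteq> W"
      using W(3) fixed by auto
    with W show ?thesis by (intro exI[of _ W]) simp
  next
    case 2
    obtain W where W: "closedin (top_of_set (fixed_set C)) W" "openin (top_of_set (fixed_set C)) W"
      "\<And>z w. \<lbrakk>z \<in> W; w \<in> fixed_set C; (z, w) \<in> C\<rbrakk> \<Longrightarrow> w \<in> W" "y \<in> W" "x \<notin> W"
      using separate[OF _ 2] xy(2) by auto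
    \<comment> \<open>Only the set around \<open>y\<close> is available here, so its complement is
      used. It is saturated because a point related in both directions to a point of
      \<open>W\<close> lies in \<open>W\<close>.\<close>
    have "(C \<inter> C\<inverse>) `` (fixed_set C - W) \<subseteq> fixed_set C - W"
      using W(3) fixed by auto
    moreover have "closedin (top_of_set (fixed_set C)) (fixed_set C - W)"
      "openin (top_of_set (fixed_set C)) (fixed_set C - W)"
      using closedin_diff[OF closedin_topspace W(2)] openin_diff[OF openin_topspace W(1)] by simp_all
    ultimately show ?thesis using W(4,5) xy(1) by (intro exI[of _ "fixed_set C - W"]) simp
  qed
qed

text \<open>If \<open>x\<close> has no loop of cost below \<epsilon>, no recurrent \<open>y\<close>
  has \<open>d x y < \<epsilon> / 2\<close>: moving both ends of a sufficiently cheap loop at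
  \<open>y\<close> to \<open>x\<close> adds at most \<open>2 * d x y\<close>.\<close>

lemma (in chain_op) closed_fixed_set_chain_rel:
  fixes f :: "('a :: uniform_space) rel"
  shows "closed (fixed_set (chain_rel m uniformity f))"
proof -
  let ?Z = "fixed_set (chain_rel m uniformity f)"
  have "\<exists>T. open T \<and> x \<in> T \<and> T \<subseteq> - ?Z" if x: "x \<in> - ?Z" for x
  proof -
    obtain d \<epsilon> where d: "d \<in> gage uniformity" "\<epsilon> > 0" and no: "\<not> (\<exists>t<\<epsilon>. chain_cost m f d x x t)"
      using x unfolding chain_rel_def fixed_set_def by auto
    note p = pseudometricD[OF gageD[OF d(1)]]
    have "y \<notin> ?Z" if y: "d x y < \<epsilon> / 2" for y
    proof
      assume "y \<in> ?Z"
      then have yy: "(y, y) \<in> chain_rel m uniformity f" unfolding fixed_set_def by simp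
      have pos: "0 < \<epsilon> - 2 * d x y" using y by simp
      obtain t where t: "t < \<epsilon> - 2 * d x y" "chain_cost m f d y y t"
        using chain_relD[OF yy d(1) pos] by (elim exE conjE)
      obtain u where u: "u \<le> d x y + t" "chain_cost m f d y x u"
        using chain_cost_change_start[OF gageD[OF d(1)] t(2), of x] by auto
      obtain v where v: "v \<le> u + d y x" "chain_cost m f d x x v"
        using chain_cost_change_end[OF gageD[OF d(1)] u(2), of x] by auto
      have "v < \<epsilon>" using u(1) v(1) t(1) p(3)[of x y] by linarith
      with v(2) no show False by auto
    qed
    then show ?thesis
      using open_gage_ball[OF d(1), of x "\<epsilon> / 2"] p(2)[of x] d(2) by (intro exI[of _ "{y. d x y < \<epsilon> / 2}"]) auto
  qed
  then have "open (- ?Z)" by (subst open_subopen) simp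
  then show ?thesis by (simp add: closed_def)
qed

section \<open>Weak topologies of increasing sequences of compact sets\<close>

text \<open>This describes a k-omega space together with its sequence of compact sets. Traces are
  required to be closed in \<open>X\<close>; when \<open>X\<close> is Hausdorff this agrees with
  being closed in \<open>L n\<close>. The Hausdorff axiom is kept as a separate hypothesis.\<close>

definition k_omega :: "'a topology \<Rightarrow> (nat \<Rightarrow> 'a set) \<Rightarrow> bool" where
  "k_omega X L \<longleftrightarrow> (\<forall>n. compactin X (L n) \<and> L n \<subseteq> L (Suc n)) \<and> (\<Union>n. L n) = topspace X \<and>
     (\<forall>W. W \<subseteq> topspace X \<longrightarrow> (\<forall>n. closedin X (W \<inter> L n)) \<longrightarrow> closedin X W)"

lemma k_omegaD:
  assumes "k_omega X L"
  shows "compactin X (L n)" "L n \<subseteq> L (Suc n)" "L n \<subseteq> topspace X" "(\<Union>n. L n) = topspace X"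
    and "\<lbrakk>W \<subseteq> topspace X; \<And>n. closedin X (W \<inter> L n)\<rbrakk> \<Longrightarrow> closedin X W"
  using assms compactin_subset_topspace[of X "L n"] unfolding k_omega_def by simp_all

lemma k_omega_mono: "k_omega X L \<Longrightarrow> i \<le> j \<Longrightarrow> L i \<subseteq> L j"
  by (rule lift_Suc_mono_le[of L, OF k_omegaD(2)])

lemma k_omega_quotient:
  assumes X: "k_omega X L" "Hausdorff_space X" and q: "quotient_map X Y q"
  shows "k_omega Y (\<lambda>n. q ` L n)"
  unfolding k_omega_def
proof (intro conjI allI impI)
  note L = k_omegaD[OF X(1)]
  have cont: "continuous_map X Y q" and surj: "q ` topspace X = topspace Y"
    using quotient_imp_continuous_map[OF q] quotient_imp_surjective_map[OF q] .
  show "compactin Y (q ` L n)" for n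
    by (rule image_compactin[OF L(1) cont])
  show "q ` L n \<subseteq> q ` L (Suc n)" for n
    by (rule image_mono[OF L(2)])
  show "(\<Union>n. q ` L n) = topspace Y"
    unfolding surj[symmetric] L(4)[symmetric] image_UN ..
  fix W assume W: "W \<subseteq> topspace Y" "\<forall>n. closedin Y (W \<inter> q ` L n)"
  let ?V = "{x \<in> topspace X. q x \<in> W}"
  have "closedin X (?V \<inter> L n)" for n
  proof -
    have "?V \<inter> L n = {x \<in> topspace X. q x \<in> W \<inter> q ` L n} \<inter> L n" using L(3) by auto
    moreover have "closedin X {x \<in> topspace X. q x \<in> W \<inter> q ` L n}"
      using W(2) by (intro closedin_continuous_map_preimage[OF cont]) auto
    ultimately show ?thesis
      using compactin_imp_closedin[OF X(2) L(1)] by (simp only: closedin_Int)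
  qed
  then have "closedin X ?V" by (rule L(5)[rotated]) simp
  then show "closedin Y W"
    using q[unfolded quotient_map_closedin, THEN conjunct2, rule_format, OF W(1)] by (rule iffD1[rotated])
qed

lemma k_omega_closed_subspace:
  assumes X: "k_omega X L" and Z: "closedin X Z"
  shows "k_omega (subtopology X Z) (\<lambda>n. Z \<inter> L n)"
  unfolding k_omega_def
proof (intro conjI allI impI)
  note L = k_omegaD[OF X]
  note top = topspace_subtopology_subset[OF closedin_subset[OF Z]]
  show "compactin (subtopology X Z) (Z \<inter> L n)" for n
    using closed_Int_compactin[OF Z L(1)] by (simp add: compactin_subtopology)
  show "Z \<inter> L n \<subseteq> Z \<inter> L (Suc n)" for n
    using L(2)[of n] by auto
  show "(\<Union>n. Z \<inter> L n) = topspace (subtopology X Z)"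
    using L(4) by auto
  fix W assume W: "W \<subseteq> topspace (subtopology X Z)"
    "\<forall>n. closedin (subtopology X Z) (W \<inter> (Z \<inter> L n))"
  have "W \<inter> (Z \<inter> L n) = W \<inter> L n" for n using W(1) top by auto
  then have "closedin X (W \<inter> L n)" for n
    using W(2) by (simp add: closedin_closed_subtopology[OF Z])
  then have "closedin X W"
    by (rule L(5)[rotated]) (use W(1) in simp)
  then show "closedin (subtopology X Z) W"
    using W(1) top by (simp add: closedin_closed_subtopology[OF Z])
qed

lemma locally_compact_compact_neighbourhood:
  assumes X: "locally_compact_space X" and K: "compactin X K"
  shows "\<exists>U L. openin X U \<and> compactin X L \<and> K \<subseteq> U \<and> U \<subseteq> L"
proof -
  have "\<forall>x\<in>K. \<exists>U L. openin X U \<and> compactin X L \<and> x \<in> U \<and> U \<subseteq> L"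
    using X compactin_subset_topspace[OF K] unfolding locally_compact_space_def by auto
  then obtain U L where UL: "\<And>x. x \<in> K \<Longrightarrow> openin X (U x) \<and> compactin X (L x) \<and> x \<in> U x \<and> U x \<subseteq> L x"
    by metis
  have "\<exists>\<F>. finite \<F> \<and> \<F> \<subseteq> U ` K \<and> K \<subseteq> \<Union>\<F>"
    by (rule compactinD[OF K]) (use UL in auto)
  then obtain F where F: "finite F" "F \<subseteq> K" "K \<subseteq> \<Union>(U ` F)"
    using finite_subset_image[of _ U K] by metis
  have "compactin X (\<Union>(L ` F))"
    using F UL by (intro compactin_Union) auto
  moreover have "openin X (\<Union>(U ` F))"
    using F UL by (intro openin_Union) auto
  moreover have "\<Union>(U ` F) \<subseteq> \<Union>(L ` F)"
    using F UL by (intro UN_mono) auto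
  ultimately show ?thesis using F(3) by (intro exI conjI)
qed

text \<open>The compact sets are enlarged so that each has an open neighbourhood inside the next.
  Every point then has a neighbourhood in some \<open>L (Suc n)\<close>, on which \<open>W\<close>
  is the closed trace \<open>W \<inter> L (Suc n)\<close>, so the complement of \<open>W\<close> is
  open.\<close>

lemma locally_compact_sigma_compact_imp_k_omega:
  assumes X: "locally_compact_space X" and \<sigma>: "sigma_compact_space X" and H: "Hausdorff_space X"
  shows "\<exists>L. k_omega X L"
proof -
  obtain K :: "nat \<Rightarrow> 'a set" where K: "\<And>n. compactin X (K n)" "(\<Union>n. K n) = topspace X"
    using \<sigma> unfolding sigma_compact_space_def by blast
  have "\<exists>L. \<forall>n. (compactin X (L n) \<and> K n \<subseteq> L n) \<and> (\<exists>U. openin X U \<and> L n \<subseteq> U \<and> U \<subseteq> L (Suc n))"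
  proof (rule dependent_nat_choice)
    show "\<exists>L. compactin X L \<and> K 0 \<subseteq> L" using K(1)[of 0] by auto
    fix L n assume "compactin X L \<and> K n \<subseteq> L"
    then obtain U L' where "openin X U" "compactin X L'" "L \<subseteq> U" "U \<subseteq> L'"
      using locally_compact_compact_neighbourhood[OF X, of L] by auto
    then show "\<exists>L'. (compactin X L' \<and> K (Suc n) \<subseteq> L') \<and> (\<exists>U. openin X U \<and> L \<subseteq> U \<and> U \<subseteq> L')"
      using compactin_Un[OF _ K(1)] by (intro exI[of _ "L' \<union> K (Suc n)"]) auto
  qed
  then obtain L where "\<forall>n. (compactin X (L n) \<and> K n \<subseteq> L n) \<and>
      (\<exists>U. openin X U \<and> L n \<subseteq> U \<and> U \<subseteq> L (Suc n))" ..
  then have L: "compactin X (L n)" "K n \<subseteq> L n" "\<exists>U. openin X U \<and> L n \<subseteq> U \<and> U \<subseteq> L (Suc n)" for n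
    by simp_all
  have cover: "(\<Union>n. L n) = topspace X"
  proof
    show "(\<Union>n. L n) \<subseteq> topspace X" using compactin_subset_topspace[OF L(1)] by auto
    show "topspace X \<subseteq> (\<Union>n. L n)" unfolding K(2)[symmetric] by (rule UN_mono[OF order_refl L(2)])
  qed
  have "closedin X W" if W: "W \<subseteq> topspace X" "\<forall>n. closedin X (W \<inter> L n)" for W
  proof -
    have "\<exists>G. openin X G \<and> x \<in> G \<and> G \<subseteq> topspace X - W" if x: "x \<in> topspace X - W" for x
    proof -
      obtain n where "x \<in> L n" using x cover by blast
      then obtain U where U: "openin X U" "x \<in> U" "U \<subseteq> L (Suc n)" using L(3)[of n] by auto
      have "openin X (U - W \<inter> L (Suc n))"
        using U(1) W(2) by (simp add: openin_diff)
      then show ?thesis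
        using U x openin_subset[OF U(1)] by (intro exI[of _ "U - W \<inter> L (Suc n)"]) auto
    qed
    then show ?thesis
      unfolding closedin_def openin_subopen[of X "topspace X - W"] using W(1) by simp
  qed
  moreover have "L n \<subseteq> L (Suc n)" for n using L(3)[of n] by auto
  ultimately have "k_omega X L"
    unfolding k_omega_def using L(1) cover by simp
  then show ?thesis by (rule exI[of _ L])
qed

text \<open>Disjoint neighbourhoods of the closed sets \<open>S\<close> and \<open>T\<close> are built as increasing unions of
  compact sets \<open>A n\<close>, \<open>B n\<close>, each obtained by separating its predecessors inside \<open>L n\<close>. The flag
  \<open>full\<close> asks that the two neighbourhoods cover the space, which makes them clopen.\<close>

lemma k_omega_separation:
  assumes X: "k_omega X L" and H: "Hausdorff_space X"
    and sep: "\<And>n P Q. \<lbrakk>compactin X P; compactin X Q; disjnt P Q; P \<subseteq> L n; Q \<subseteq> L n\<rbrakk> \<Longrightarrow>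
      \<exists>G H A B. openin X G \<and> openin X H \<and> compactin X A \<and> compactin X B \<and> disjnt A B \<and>
        A \<subseteq> L n \<and> B \<subseteq> L n \<and> P \<subseteq> G \<and> G \<inter> L n \<subseteq> A \<and> Q \<subseteq> H \<and> H \<inter> L n \<subseteq> B \<and>
        (full \<longrightarrow> L n \<subseteq> A \<union> B)"
    and S: "closedin X S" and T: "closedin X T" and "disjnt S T"
  shows "\<exists>U V. openin X U \<and> openin X V \<and> S \<subseteq> U \<and> T \<subseteq> V \<and> disjnt U V \<and>
    (full \<longrightarrow> U \<union> V = topspace X)"
proof -
  have L: "\<And>n. compactin X (L n)" "\<And>n. L n \<subseteq> L (Suc n)" "(\<Union>n. L n) = topspace X"
    using k_omegaD[OF X] by simp_all
  define inv where "inv n = (\<lambda>(A, B). compactin X A \<and> compactin X B \<and> disjnt A B \<and>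
      A \<subseteq> L n \<and> B \<subseteq> L n \<and> S \<inter> L n \<subseteq> A \<and> T \<inter> L n \<subseteq> B)" for n
  \<comment> \<open>The sets \<open>G\<close>, \<open>H\<close> are open in the whole space, but
    only their traces on \<open>L (Suc n)\<close> are controlled. Covering is demanded from index 1
    on, which suffices because \<open>L 0\<close> lies in \<open>L 1\<close>.\<close>
  define nxt where "nxt n = (\<lambda>(A, B) (A', B'). \<exists>G H. openin X G \<and> openin X H \<and> A \<subseteq> G \<and>
      G \<inter> L (Suc n) \<subseteq> A' \<and> B \<subseteq> H \<and> H \<inter> L (Suc n) \<subseteq> B' \<and> (full \<longrightarrow> L (Suc n) \<subseteq> A' \<union> B'))" for n
  have "\<exists>F. \<forall>n. inv n (F n) \<and> nxt n (F n) (F (Suc n))"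
  proof (rule dependent_nat_choice)
    show "\<exists>p. inv 0 p"
      using \<open>disjnt S T\<close> closed_Int_compactin[OF S L(1)] closed_Int_compactin[OF T L(1)]
      unfolding inv_def disjnt_def
      by (intro exI[of _ "(S \<inter> L 0, T \<inter> L 0)"]) auto
    fix p n assume "inv n p"
    obtain A B where p: "p = (A, B)" by (cases p)
    with \<open>inv n p\<close> have AB: "compactin X A" "compactin X B" "disjnt A B"
      "A \<subseteq> L n" "B \<subseteq> L n" "S \<inter> L n \<subseteq> A" "T \<inter> L n \<subseteq> B"
      unfolding inv_def by simp_all
    let ?P = "A \<union> (S \<inter> L (Suc n))" and ?Q = "B \<union> (T \<inter> L (Suc n))"
    have PQ: "compactin X ?P" "compactin X ?Q"
      using AB closed_Int_compactin[OF S L(1)] closed_Int_compactin[OF T L(1)]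
      by (simp_all add: compactin_Un)
    \<comment> \<open>A point of \<open>A\<close> in \<open>T\<close> lies in \<open>L n\<close>,
      hence in \<open>B\<close>, which is impossible; the same holds with the roles
      exchanged.\<close>
    have PQ': "disjnt ?P ?Q" "?P \<subseteq> L (Suc n)" "?Q \<subseteq> L (Suc n)"
      using AB \<open>disjnt S T\<close> L(2)[of n] unfolding disjnt_def by auto
    obtain G H A' B' where "openin X G" "openin X H" "compactin X A'" "compactin X B'"
      "disjnt A' B'" "A' \<subseteq> L (Suc n)" "B' \<subseteq> L (Suc n)" "?P \<subseteq> G" "G \<inter> L (Suc n) \<subseteq> A'" "?Q \<subseteq> H"
      "H \<inter> L (Suc n) \<subseteq> B'" "full \<longrightarrow> L (Suc n) \<subseteq> A' \<union> B'"
      using sep[OF PQ PQ'] by (elim exE conjE)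
    then show "\<exists>q. inv (Suc n) q \<and> nxt n p q"
      unfolding p inv_def nxt_def
      by (intro exI[of _ "(A', B')"]) auto
  qed
  then obtain F where F: "\<And>n. inv n (F n)" "\<And>n. nxt n (F n) (F (Suc n))" by blast
  define A B where "A n = fst (F n)" and "B n = snd (F n)" for n
  have AB: "disjnt (A n) (B n)" "A n \<subseteq> L n" "B n \<subseteq> L n" "S \<inter> L n \<subseteq> A n" "T \<inter> L n \<subseteq> B n" for n
    using F(1)[of n] unfolding inv_def A_def B_def by (auto split: prod.splits)
  have "\<exists>G H. openin X G \<and> openin X H \<and> A n \<subseteq> G \<and> G \<inter> L (Suc n) \<subseteq> A (Suc n) \<and> B n \<subseteq> H \<and>
      H \<inter> L (Suc n) \<subseteq> B (Suc n) \<and> (full \<longrightarrow> L (Suc n) \<subseteq> A (Suc n) \<union> B (Suc n))" for n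
    using F(2)[of n] unfolding nxt_def A_def B_def by (simp add: case_prod_beta)
  then obtain G H where GH: "\<And>n. openin X (G n)" "\<And>n. openin X (H n)" "\<And>n. A n \<subseteq> G n"
    "\<And>n. G n \<inter> L (Suc n) \<subseteq> A (Suc n)" "\<And>n. B n \<subseteq> H n" "\<And>n. H n \<inter> L (Suc n) \<subseteq> B (Suc n)"
    and full: "\<And>n. full \<Longrightarrow> L (Suc n) \<subseteq> A (Suc n) \<union> B (Suc n)"
    by metis
  have open_Union: "openin X (\<Union>n. C n)"
    if C: "\<And>n. C n \<subseteq> L n" "\<And>n. C n \<subseteq> J n" "\<And>n. J n \<inter> L (Suc n) \<subseteq> C (Suc n)"
      "\<And>n. openin X (J n)" for C J
  proof -
    let ?W = "topspace X - (\<Union>n. C n)"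
    have mono: "C i \<subseteq> C j" if "i \<le> j" for i j
      by (rule lift_Suc_mono_le[of C, OF _ that]) (use C(1-3) L(2) in force)
    \<comment> \<open>The trace of the union on \<open>L n\<close> is cut out by the open sets
      \<open>J k\<close> with \<open>k \<ge> n\<close>. Earlier ones are omitted since
      \<open>J k\<close> is controlled only on \<open>L (Suc k)\<close>, which contains
      \<open>L n\<close> for these \<open>k\<close>.\<close>
    have eq: "?W \<inter> L n = L n - (\<Union>k\<in>{n..}. J k)" for n
    proof -
      have "x \<in> (\<Union>k\<in>{n..}. J k) \<longleftrightarrow> x \<in> (\<Union>k. C k)" if "x \<in> L n" for x
      proof
        assume "x \<in> (\<Union>k\<in>{n..}. J k)"
        then obtain k where "n \<le> k" "x \<in> J k" by auto
        moreover have "x \<in> L (Suc k)" using k_omega_mono[OF X, of n "Suc k"] \<open>n \<le> k\<close> that by auto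
        ultimately show "x \<in> (\<Union>k. C k)" using C(3)[of k] by auto
      next
        assume "x \<in> (\<Union>k. C k)"
        then obtain k where "x \<in> C k" by blast
        then have "x \<in> J (max n k)" using mono[of k "max n k"] C(2) by auto
        then show "x \<in> (\<Union>k\<in>{n..}. J k)" by (intro UN_I[of "max n k"]) auto
      qed
      then show ?thesis using L(3) by auto
    qed
    have "closedin X (?W \<inter> L n)" for n
      unfolding eq using C(4) compactin_imp_closedin[OF H L(1)]
      by (intro closedin_diff openin_Union) auto
    then have "closedin X ?W" by (rule k_omegaD(5)[OF X, rotated]) simp
    moreover have "(\<Union>n. C n) \<subseteq> topspace X" unfolding L(3)[symmetric] by (rule UN_mono) (auto intro: C(1)[THEN subsetD])
    ultimately show ?thesis by (simp add: openin_closedin_eq)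
  qed
  have mono: "A i \<subseteq> A j" "B i \<subseteq> B j" if "i \<le> j" for i j
  proof -
    have "A n \<subseteq> A (Suc n)" "B n \<subseteq> B (Suc n)" for n
      using GH(3-6)[of n] AB(2,3)[of n] L(2)[of n] by blast+
    then show "A i \<subseteq> A j" "B i \<subseteq> B j"
      using lift_Suc_mono_le[of A, OF _ that] lift_Suc_mono_le[of B, OF _ that] by auto
  qed
  have "disjnt (\<Union>n. A n) (\<Union>n. B n)"
  proof -
    have "A i \<inter> B j = {}" for i j
      using mono(1)[of i "max i j"] mono(2)[of j "max i j"] AB(1)[of "max i j"]
      unfolding disjnt_def by auto
    then show ?thesis unfolding disjnt_def by auto
  qed
  moreover have "openin X (\<Union>n. A n)" "openin X (\<Union>n. B n)"
    by (rule open_Union[OF AB(2) GH(3,4,1)] open_Union[OF AB(3) GH(5,6,2)])+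
  moreover have "S \<subseteq> (\<Union>n. A n)"
  proof
    fix x assume "x \<in> S"
    then obtain n where "x \<in> L n" using closedin_subset[OF S] L(3) by auto
    then show "x \<in> (\<Union>n. A n)" using AB(4)[of n] \<open>x \<in> S\<close> by auto
  qed
  moreover have "T \<subseteq> (\<Union>n. B n)"
  proof
    fix x assume "x \<in> T"
    then obtain n where "x \<in> L n" using closedin_subset[OF T] L(3) by auto
    then show "x \<in> (\<Union>n. B n)" using AB(5)[of n] \<open>x \<in> T\<close> by auto
  qed
  moreover have "(\<Union>n. A n) \<union> (\<Union>n. B n) = topspace X" if full
  proof
    show "(\<Union>n. A n) \<union> (\<Union>n. B n) \<subseteq> topspace X"
      unfolding L(3)[symmetric] by (intro Un_least UN_mono order_refl AB(2,3))
    show "topspace X \<subseteq> (\<Union>n. A n) \<union> (\<Union>n. B n)"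
    proof
      fix x assume "x \<in> topspace X"
      then obtain n where "x \<in> L n" using L(3) by auto
      then show "x \<in> (\<Union>n. A n) \<union> (\<Union>n. B n)" using L(2)[of n] full[OF that, of n] by auto
    qed
  qed
  ultimately have "openin X (\<Union>n. A n) \<and> openin X (\<Union>n. B n) \<and> S \<subseteq> (\<Union>n. A n) \<and> T \<subseteq> (\<Union>n. B n) \<and>
      disjnt (\<Union>n. A n) (\<Union>n. B n) \<and> (full \<longrightarrow> (\<Union>n. A n) \<union> (\<Union>n. B n) = topspace X)"
    by simp
  then show ?thesis by (intro exI)
qed

text \<open>Inside \<open>L n\<close> compact sets are separated twice: first \<open>P\<close> from
  \<open>Q\<close>, giving the compact neighbourhood \<open>L n - V\<close> of \<open>P\<close>,
  then this neighbourhood from \<open>Q\<close>, giving \<open>L n - U'\<close> around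
  \<open>Q\<close>.\<close>

lemma k_omega_imp_normal:
  assumes X: "k_omega X L" and H: "Hausdorff_space X"
  shows "normal_space X"
  unfolding normal_space_def
proof (intro allI impI)
  fix S T assume ST: "closedin X S \<and> closedin X T \<and> disjnt S T"
  have "\<exists>U V. openin X U \<and> openin X V \<and> S \<subseteq> U \<and> T \<subseteq> V \<and> disjnt U V \<and>
      (False \<longrightarrow> U \<union> V = topspace X)"
  proof (rule k_omega_separation[OF X H])
    fix n P Q assume PQ: "compactin X P" "compactin X Q" "disjnt P Q" "P \<subseteq> L n" "Q \<subseteq> L n"
    have Ln: "compactin X (L n)" "closedin X (L n)"
      using k_omegaD(1)[OF X] compactin_imp_closedin[OF H] by simp_all
    obtain U V where UV: "openin X U" "openin X V" "P \<subseteq> U" "Q \<subseteq> V" "disjnt U V"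
      using Hausdorff_space_compact_separation[OF H PQ(1-3)] .
    have A: "compactin X (L n - V)"
      by (rule closed_compactin[OF Ln(1) Diff_subset closedin_diff[OF Ln(2) UV(2)]])
    have dis: "disjnt (L n - V) Q" using UV(4) unfolding disjnt_def by auto
    obtain U' V' where UV': "openin X U'" "openin X V'" "L n - V \<subseteq> U'" "Q \<subseteq> V'"
      "disjnt U' V'"
      using Hausdorff_space_compact_separation[OF H A PQ(2) dis] .
    have B: "compactin X (L n - U')"
      by (rule closed_compactin[OF Ln(1) Diff_subset closedin_diff[OF Ln(2) UV'(1)]])
    show "\<exists>G H A B. openin X G \<and> openin X H \<and> compactin X A \<and> compactin X B \<and> disjnt A B \<and>
        A \<subseteq> L n \<and> B \<subseteq> L n \<and> P \<subseteq> G \<and> G \<inter> L n \<subseteq> A \<and> Q \<subseteq> H \<and> H \<inter> L n \<subseteq> B \<and>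
        (False \<longrightarrow> L n \<subseteq> A \<union> B)"
      by (rule exI[of _ U], rule exI[of _ V'], rule exI[of _ "L n - V"], rule exI[of _ "L n - U'"])
        (use UV UV' A B in \<open>auto simp: disjnt_def\<close>)
  qed (use ST in auto)
  then show "\<exists>U V. openin X U \<and> openin X V \<and> S \<subseteq> U \<and> T \<subseteq> V \<and> disjnt U V" by simp
qed

section \<open>Strong zero-dimensionality\<close>

lemma totally_disconnected_space_separated:
  assumes "totally_disconnected_space X" "x \<in> topspace X" "y \<in> topspace X" "x \<noteq> y"
  shows "separated_between X {x} {y}"
proof -
  have "y \<notin> \<Inter>{W. closedin X W \<and> openin X W \<and> x \<in> W}"
    using assms unfolding totally_disconnected_space_def by simp
  then show ?thesis unfolding separated_between using assms(3) by auto
qed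

lemma totally_disconnected_imp_Hausdorff:
  assumes "totally_disconnected_space X"
  shows "Hausdorff_space X"
  unfolding Hausdorff_space_def
proof (intro allI impI, elim conjE)
  fix x y assume "x \<in> topspace X" "y \<in> topspace X" "x \<noteq> y"
  then have "separated_between X {x} {y}"
    by (rule totally_disconnected_space_separated[OF assms])
  then show "\<exists>U V. openin X U \<and> openin X V \<and> x \<in> U \<and> y \<in> V \<and> disjnt U V"
    unfolding separated_between_def by auto
qed

text \<open>The separation is applied with covering to \<open>C\<close> and the complement of its
  open neighbourhood \<open>G\<close>; two disjoint open sets that cover the space are
  clopen.\<close>

lemma k_omega_imp_strongly_zero_dimensional:
  assumes X: "k_omega X L" and td: "totally_disconnected_space X"
  shows "strongly_zero_dimensional_space X"
  unfolding strongly_zero_dimensional_space_def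
proof (intro allI impI)
  note H = totally_disconnected_imp_Hausdorff[OF td]
  fix C N assume "closedin X C \<and> N \<subseteq> topspace X \<and> (\<exists>G. openin X G \<and> C \<subseteq> G \<and> G \<subseteq> N)"
  then obtain G where C: "closedin X C" and G: "openin X G" "C \<subseteq> G" "G \<subseteq> N" by blast
  have "\<exists>U V. openin X U \<and> openin X V \<and> C \<subseteq> U \<and> topspace X - G \<subseteq> V \<and> disjnt U V \<and>
      (True \<longrightarrow> U \<union> V = topspace X)"
  proof (rule k_omega_separation[OF X H])
    fix n P Q assume PQ: "compactin X P" "compactin X Q" "disjnt P Q" "P \<subseteq> L n" "Q \<subseteq> L n"
    have Ln: "compactin X (L n)"
      by (rule k_omegaD(1)[OF X])
    have sub: "P \<subseteq> topspace X" "Q \<subseteq> topspace X"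
      using PQ(1,2) by (simp_all add: compactin_subset_topspace)
    have "separated_between X {x} {y}" if "x \<in> P" "y \<in> Q" for x y
      using that PQ(3) sub by (intro totally_disconnected_space_separated[OF td]) (auto simp: disjnt_iff)
    \<comment> \<open>Compactness of \<open>P\<close> and of \<open>Q\<close> turns pointwise
      separation by clopen sets into one clopen set between them.\<close>
    then have "separated_between X P Q"
      using sub by (simp add: separated_between_pointwise_left[OF PQ(1)]
          separated_between_pointwise_right[OF PQ(2)] subset_eq)
    then obtain W where W: "closedin X W" "openin X W" "P \<subseteq> W" "Q \<subseteq> topspace X - W"
      unfolding separated_between by blast
    have cpt: "compactin X (W \<inter> L n)" "compactin X ((topspace X - W) \<inter> L n)"
      using W(1,2) by (simp_all add: closed_Int_compactin Ln closedin_diff)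
    show "\<exists>G H A B. openin X G \<and> openin X H \<and> compactin X A \<and> compactin X B \<and> disjnt A B \<and>
        A \<subseteq> L n \<and> B \<subseteq> L n \<and> P \<subseteq> G \<and> G \<inter> L n \<subseteq> A \<and> Q \<subseteq> H \<and> H \<inter> L n \<subseteq> B \<and>
        (True \<longrightarrow> L n \<subseteq> A \<union> B)"
      by (rule exI[of _ W], rule exI[of _ "topspace X - W"], rule exI[of _ "W \<inter> L n"],
          rule exI[of _ "(topspace X - W) \<inter> L n"])
        (use W cpt compactin_subset_topspace[OF Ln] in \<open>auto simp: disjnt_def\<close>)
  qed (use C G in \<open>auto simp: disjnt_def\<close>)
  then obtain U V where UV: "openin X U" "openin X V" "C \<subseteq> U" "topspace X - G \<subseteq> V" "disjnt U V"
    "U \<union> V = topspace X"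
    by auto
  have "U = topspace X - V" "U \<subseteq> N"
    using UV(4-6) G(3) unfolding disjnt_def by auto
  moreover have "closedin X (topspace X - V)"
    using UV(2) by (simp add: closedin_diff)
  ultimately show "\<exists>W. closedin X W \<and> openin X W \<and> C \<subseteq> W \<and> W \<subseteq> N"
    using UV by (intro exI[of _ U]) simp
qed

lemma completely_Hausdorff_imp_Hausdorff:
  assumes "completely_Hausdorff_space X"
  shows "Hausdorff_space X"
  unfolding Hausdorff_space_def
proof (intro allI impI, elim conjE)
  fix x y assume xy: "x \<in> topspace X" "y \<in> topspace X" "x \<noteq> y"
  then obtain g where g: "continuous_map X euclideanreal g" "g x \<noteq> g y"
    using assms unfolding completely_Hausdorff_space_def by blast
  obtain U V where UV: "open U" "open V" "g x \<in> U" "g y \<in> V" "U \<inter> V = {}"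
    using hausdorff[OF g(2)] by auto
  show "\<exists>U V. openin X U \<and> openin X V \<and> x \<in> U \<and> y \<in> V \<and> disjnt U V"
    by (rule exI[of _ "{z \<in> topspace X. g z \<in> U}"], rule exI[of _ "{z \<in> topspace X. g z \<in> V}"])
      (use UV xy openin_continuous_map_preimage[OF g(1)] in \<open>auto simp: disjnt_def\<close>)
qed

section \<open>Properties of the three quotients\<close>

theorem corollary7p14:
  fixes f :: "('a :: {uniform_space, t2_space}) rel"
  shows
    "(let X = (euclidean :: 'a topology);
          A = aubry_mather uniformity f;
          C = conley uniformity f;
          EA = Id \<union> (A \<inter> A\<inverse>);
          EC = Id \<union> (C \<inter> C\<inverse>);
          QA = quotient_topology X EA;
          QC = quotient_topology X EC;
          Q = quotient_topology (subtopology X (fixed_set C)) (C \<inter> C\<inverse>)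
      in
        (equiv UNIV EA \<and> closed EA \<and> completely_Hausdorff_space QA) \<and>
        (equiv UNIV EC \<and> closed EC \<and> completely_Hausdorff_space QC) \<and>
        (equiv (fixed_set C) (C \<inter> C\<inverse>) \<and> totally_disconnected_space Q) \<and>
        (locally_compact_space X \<and> sigma_compact_space X \<longrightarrow>
           Hausdorff_space QA \<and> normal_space QA \<and>
           Hausdorff_space QC \<and> normal_space QC \<and>
           Hausdorff_space Q \<and> normal_space Q \<and> strongly_zero_dimensional_space Q))"
proof -
  let ?C = "chain_rel max uniformity f" and ?A = "chain_rel (+) uniformity f"
  interpret A: chain_op "(+)" by (rule chain_op_plus)
  interpret C: chain_op max by (rule chain_op_max)
  let ?X = "euclidean :: 'a topology"
  let ?EA = "Id \<union> (?A \<inter> ?A\<inverse>)" and ?EC = "Id \<union> (?C \<inter> ?C\<inverse>)"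
  let ?Z = "fixed_set ?C"
  let ?QA = "quotient_topology ?X ?EA" and ?QC = "quotient_topology ?X ?EC"
    and ?Q = "quotient_topology (top_of_set ?Z) (?C \<inter> ?C\<inverse>)"
  have EA: "?EA = {(x, y). \<forall>p\<in>chain_metric (+) f ` gage uniformity. p x y = 0}"
    by (rule A.chain_equivalence_eq) (rule gage_uniformity_separates)
  have EC: "?EC = {(x, y). \<forall>p\<in>chain_metric max f ` gage uniformity. p x y = 0}"
    by (rule C.chain_equivalence_eq) (rule gage_uniformity_separates)
  have PA: "chain_metric (+) f ` gage uniformity \<subseteq> gage uniformity"
    by (intro image_subsetI A.chain_metric_in_gage)
  have PC: "chain_metric max f ` gage uniformity \<subseteq> gage uniformity"
    by (intro image_subsetI C.chain_metric_in_gage)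
  have A: "equiv UNIV ?EA" "closed ?EA" "completely_Hausdorff_space ?QA"
    subgoal unfolding EA by (rule equiv_zero_set_pseudometrics) (rule gageD[OF subsetD[OF PA]])
    subgoal unfolding EA by (rule closed_zero_set_gage[OF PA])
    by (rule completely_Hausdorff_quotient_gage[OF PA EA])
  have C: "equiv UNIV ?EC" "closed ?EC" "completely_Hausdorff_space ?QC"
    subgoal unfolding EC by (rule equiv_zero_set_pseudometrics) (rule gageD[OF subsetD[OF PC]])
    subgoal unfolding EC by (rule closed_zero_set_gage[OF PC])
    by (rule completely_Hausdorff_quotient_gage[OF PC EC])
  have Q: "equiv ?Z (?C \<inter> ?C\<inverse>)" "totally_disconnected_space ?Q"
    by (rule equiv_fixed_set[OF C.trans_chain_rel] conley_quotient_totally_disconnected)+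
  \<comment> \<open>The inductive separation takes the Hausdorff property as a hypothesis, so it is
    derived first, from the separation of points already established in the quotients.\<close>
  note HA = completely_Hausdorff_imp_Hausdorff[OF A(3)]
    and HC = completely_Hausdorff_imp_Hausdorff[OF C(3)]
    and HQ = totally_disconnected_imp_Hausdorff[OF Q(2)]
  have sigma: "Hausdorff_space ?QA \<and> normal_space ?QA \<and> Hausdorff_space ?QC \<and> normal_space ?QC \<and>
      Hausdorff_space ?Q \<and> normal_space ?Q \<and> strongly_zero_dimensional_space ?Q"
    if lc: "locally_compact_space ?X \<and> sigma_compact_space ?X"
  proof -
    have H: "Hausdorff_space ?X"
      unfolding Hausdorff_space_def using hausdorff by (auto simp: disjnt_def)
    obtain L where L: "k_omega ?X L"
      using locally_compact_sigma_compact_imp_k_omega[OF conjunct1[OF lc] conjunct2[OF lc] H] ..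
    \<comment> \<open>Closedness of the recurrent set lets the weak topology restrict to it before
      the quotient is formed.\<close>
    have "closedin ?X ?Z"
      using C.closed_fixed_set_chain_rel[of f] by simp
    note LZ = k_omega_closed_subspace[OF L this]
    note quot = k_omega_quotient[OF _ _ quotient_map_quotient_topology]
    note kQ = quot[OF LZ Hausdorff_space_subtopology[OF H], of "?C \<inter> ?C\<inverse>"]
    show ?thesis
      using HA HC HQ k_omega_imp_normal[OF quot[OF L H, of ?EA] HA]
        k_omega_imp_normal[OF quot[OF L H, of ?EC] HC] k_omega_imp_normal[OF kQ HQ]
        k_omega_imp_strongly_zero_dimensional[OF kQ Q(2)]
      by (intro conjI)
  qed
  show ?thesis
    unfolding Let_def aubry_mather_eq_chain_rel conley_eq_chain_rel
    by (intro conjI A C Q) (rule impI, rule sigma)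
qed

end
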